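(* Let $r$ be a fixed positive integer. For every $\varepsilon>0$ there exist constants $C=C(r,\varepsilon)>0$ and $p_0=p_0(r,\varepsilon)$ such that the following holds for every prime $p\ge p_0$. Let $\mathcal{M}\subseteq\mathbb{F}_p$ be an arbitrary set of cardinality $M\geq 1$ and let $\mathcal{K}\subseteq\mathbb{F}_p^*$ be an interval of length $K\ge p^{1/r}$. Then for all $a\in\mathbb{F}_p^*$ and arbitrary complex weights $\boldsymbol\alpha=\{\alpha_m\}_{m\in\mathcal{M}}$, $\boldsymbol\gamma=\{\gamma_k\}_{k\in\mathcal{K}}$, $$\Bigl|\sum_{m\in\mathcal{M}}\sum_{k\in\mathcal{K}}\alpha_m\gamma_k\,\mathbf{e}_p(amk^{-1})\Bigr|\le C\,\|\boldsymbol\alpha\|_\infty\|\boldsymbol\gamma\|_\infty\,MK\,p^{\varepsilon}\Bigl(\frac1M+\frac{p^{1+1/r}}{MK^2}\Bigr)^{7/(24r)}.$$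
   Context: $\mathbf{e}_p(z)=\exp(2\pi i z/p)$; $k^{-1}$ is the inverse of $k$ in $\mathbb{F}_p^*$. $\mathbb{F}_p$ is identified with $\{0,1,\dots,p-1\}$; an interval in $\mathbb{F}_p$ of length $K$ is the set of residues modulo $p$ of $K$ consecutive integers $K_0+1,\dots,K_0+K$. $\|\boldsymbol\alpha\|_\infty=\max_m|\alpha_m|$ and similarly for $\boldsymbol\gamma$. The paper's notation $f\ll p^{o(1)}g$ means: for every $\varepsilon>0$ there is a constant $C_\varepsilon$ with $|f|\le C_\varepsilon p^\varepsilon g$ for all sufficiently large $p$; this has been written out in the claim. *)

theory Defs
  imports "HOL-Analysis.Analysis" "HOL-Number_Theory.Number_Theory"
begin

(* Elements of the prime field are integers in {0..<p}; multiplicative inverses are taken with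
   the library's modular_inverse. *)

definition prime_field :: "nat \<Rightarrow> int set" where
  "prime_field p = {0..<int p}"

definition prime_field_units :: "nat \<Rightarrow> int set" where
  "prime_field_units p = prime_field p - {0}"

definition residue_interval :: "nat \<Rightarrow> int \<Rightarrow> nat \<Rightarrow> int set" where
  "residue_interval p k0 K = (\<lambda>j. j mod int p) ` {k0 + 1..k0 + int K}"

definition e_char :: "nat \<Rightarrow> int \<Rightarrow> complex" where
  "e_char p z = exp (2 * of_real pi * \<i> * of_int z / of_nat p)"

(* Only meaningful for a finite nonempty index set A. *)
definition sup_weight :: "int set \<Rightarrow> (int \<Rightarrow> complex) \<Rightarrow> real" where
  "sup_weight A w = Max ((\<lambda>x. norm (w x)) ` A)"

end

theory Submission
  imports Defs
begin

text \<open>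
  Hoelder's inequality over \<open>m\<close>, extended to all residues, removes the set \<open>\<M>\<close>; expanding the
  even moment \<open>2 r\<close> removes the weights \<open>\<gamma>\<close> and leaves \<open>p J\<close>, where \<open>J\<close> counts the
  \<open>2 r\<close>-tuples from the interval with vanishing alternating sum of reciprocals. Since \<open>J\<close> is
  a count, the interval may be replaced by the larger family \<open>k + u v\<close> with \<open>u \<le> U\<close>, \<open>v \<le> V\<close>,
  without any boundary terms. From \<open>1 / (k + u v) = u\<inverse> / (k u\<inverse> + v)\<close> and a Jensen inequality
  weighted by the multiplicity of \<open>\<mu> = k u\<inverse>\<close>, the problem reduces to the complete moment over
  \<open>\<lambda>\<close> and \<open>\<mu>\<close> of the sums over \<open>v\<close> of \<open>e(\<lambda> / (\<mu> + v))\<close>, which is elementary because a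
  nonzero rational function has few zeros. Taking \<open>V \<approx> p\<^sup>1\<^sup>/\<^sup>r\<close> and
  \<open>U \<approx> min (K / V) (p / K)\<close> yields the estimate even with exponent \<open>1 / (2 r)\<close>.
\<close>

subsection \<open>Additive characters and even moments\<close>

lemma e_char_add: "e_char p (x + y) = e_char p x * e_char p y"
  by (simp add: e_char_def exp_add [symmetric] add_divide_distrib ring_distribs)

lemma e_char_0 [simp]: "e_char p 0 = 1"
  by (simp add: e_char_def)

lemma e_char_eq_cis: "e_char p x = cis (2 * pi * real_of_int x / real p)"
  by (simp add: e_char_def cis_conv_exp mult_ac)

lemma norm_e_char [simp]: "norm (e_char p x) = 1"
  by (simp add: e_char_eq_cis)

lemma cnj_e_char: "cnj (e_char p x) = e_char p (- x)"
  by (simp add: e_char_eq_cis cis_cnj)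

lemma e_char_sum: "e_char p (\<Sum>i\<in>A. f i) = (\<Prod>i\<in>A. e_char p (f i))"
  by (induction A rule: infinite_finite_induct) (simp_all add: e_char_add)

lemma e_char_of_nat_mult: "e_char p (int n * x) = e_char p x ^ n"
  by (induction n) (simp_all add: ring_distribs e_char_add)

lemma e_char_eq_1_iff:
  assumes "p > 0"
  shows "e_char p x = 1 \<longleftrightarrow> int p dvd x"
proof -
  have "e_char p x = 1 \<longleftrightarrow> (\<exists>n::int. 2 * pi * real_of_int x / real p = of_int (2 * n) * pi)"
    by (simp add: e_char_def exp_eq_1)
  also have "\<dots> \<longleftrightarrow> (\<exists>n::int. real_of_int x = real_of_int (int p * n))"
    using assms by (intro ex_cong1) (simp add: field_simps)
  also have "\<dots> \<longleftrightarrow> int p dvd x"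
    by (simp only: of_int_eq_iff dvd_def)
  finally show ?thesis .
qed

lemma e_char_cong:
  assumes "p > 0" "[x = y] (mod int p)"
  shows "e_char p x = e_char p y"
proof -
  have "e_char p (x - y) = 1"
    using assms by (simp add: e_char_eq_1_iff cong_iff_dvd_diff)
  then show ?thesis
    using e_char_add [of p "x - y" y] by simp
qed

lemma sum_e_char:
  assumes "p > 0"
  shows "(\<Sum>l\<in>{0..<int p}. e_char p (l * x)) = (if int p dvd x then of_nat p else 0)"
proof -
  have "(\<Sum>l\<in>{0..<int p}. e_char p (l * x)) = (\<Sum>n<p. e_char p (int n * x))"
    by (rule sum.reindex_bij_witness [of _ int nat]) auto
  also have "\<dots> = (\<Sum>n<p. e_char p x ^ n)"
    by (simp add: e_char_of_nat_mult)
  also have "\<dots> = (if int p dvd x then of_nat p else 0)"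
  proof (cases "int p dvd x")
    case True
    then have "e_char p x = 1" using assms by (simp add: e_char_eq_1_iff)
    with True show ?thesis by simp
  next
    case False
    have "e_char p x ^ p = 1"
      using assms by (simp add: e_char_of_nat_mult [symmetric] e_char_eq_1_iff)
    with False assms show ?thesis
      by (simp add: geometric_sum e_char_eq_1_iff)
  qed
  finally show ?thesis .
qed

text \<open>The signs follow the parity of the position, matching the alternation of a sum with its
  conjugate in an even power of its modulus; no pairing of indices is required.\<close>

definition alternating_sum :: "nat \<Rightarrow> (nat \<Rightarrow> int) \<Rightarrow> int" where
  "alternating_sum n f = (\<Sum>i<n. (- 1) ^ i * f i)"

text \<open>The solutions counted by an additive energy. The index set and \<open>\<phi>\<close> are
  kept general so that one notion serves the original interval, the family of triples
  \<open>((u, k), v)\<close> and the short range of \<open>v\<close>. Distinct indices count as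
  distinct even where \<open>\<phi>\<close> takes equal values.\<close>

definition energy_tuples :: "nat \<Rightarrow> nat \<Rightarrow> 'a set \<Rightarrow> ('a \<Rightarrow> int) \<Rightarrow> (nat \<Rightarrow> 'a) set" where
  "energy_tuples p n A \<phi> =
     {w \<in> {..<n} \<rightarrow>\<^sub>E A. int p dvd alternating_sum n (\<lambda>i. \<phi> (w i))}"

lemma finite_energy_tuples: "finite A \<Longrightarrow> finite (energy_tuples p n A \<phi>)"
  by (auto simp: energy_tuples_def intro!: finite_PiE)

lemma norm_even_power_eq_prod:
  "complex_of_real (norm z ^ (2 * r)) = (\<Prod>i<2 * r. if even i then z else cnj z)"
proof (induction r)
  case (Suc r)
  have "complex_of_real (norm z ^ (2 * Suc r)) = (z * cnj z) * complex_of_real (norm z ^ (2 * r))"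
    by (simp add: complex_norm_square [symmetric] power2_eq_square)
  with Suc show ?case by (simp add: mult_ac)
qed simp

text \<open>Expanding the product of sums puts the frequency \<open>l\<close> in front of the
  alternating sum of the chosen \<open>\<phi>\<close> values; orthogonality in \<open>l\<close> then
  keeps precisely the energy tuples.\<close>

lemma even_moment_eq:
  assumes "p > 0" "finite A"
  shows "complex_of_real (\<Sum>l\<in>{0..<int p}. norm (\<Sum>x\<in>A. c x * e_char p (l * \<phi> x)) ^ (2 * r))
       = of_nat p * (\<Sum>w\<in>energy_tuples p (2 * r) A \<phi>. \<Prod>i<2 * r. if even i then c (w i) else cnj (c (w i)))"
proof -
  define d where "d i x = (if even i then c x else cnj (c x))" for i :: nat and x
  have "complex_of_real (norm (\<Sum>x\<in>A. c x * e_char p (l * \<phi> x)) ^ (2 * r))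
      = (\<Sum>w\<in>{..<2 * r} \<rightarrow>\<^sub>E A. (\<Prod>i<2 * r. d i (w i)) *
            e_char p (l * alternating_sum (2 * r) (\<lambda>i. \<phi> (w i))))" for l
  proof -
    have "complex_of_real (norm (\<Sum>x\<in>A. c x * e_char p (l * \<phi> x)) ^ (2 * r))
        = (\<Prod>i<2 * r. \<Sum>x\<in>A. d i x * e_char p (l * ((- 1) ^ i * \<phi> x)))"
      unfolding norm_even_power_eq_prod
      by (intro prod.cong refl) (auto simp: d_def cnj_e_char)
    also have "\<dots> = (\<Sum>w\<in>{..<2 * r} \<rightarrow>\<^sub>E A. \<Prod>i<2 * r. d i (w i) * e_char p (l * ((- 1) ^ i * \<phi> (w i))))"
      using assms by (intro prod_sum_PiE) auto
    finally show ?thesis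
      by (simp add: prod.distrib e_char_sum [symmetric] alternating_sum_def sum_distrib_left)
  qed
  then have "complex_of_real (\<Sum>l\<in>{0..<int p}. norm (\<Sum>x\<in>A. c x * e_char p (l * \<phi> x)) ^ (2 * r))
      = (\<Sum>l\<in>{0..<int p}. \<Sum>w\<in>{..<2 * r} \<rightarrow>\<^sub>E A. (\<Prod>i<2 * r. d i (w i)) *
            e_char p (l * alternating_sum (2 * r) (\<lambda>i. \<phi> (w i))))"
    by simp
  also have "\<dots> = (\<Sum>w\<in>{..<2 * r} \<rightarrow>\<^sub>E A. (\<Prod>i<2 * r. d i (w i)) *
            (\<Sum>l\<in>{0..<int p}. e_char p (l * alternating_sum (2 * r) (\<lambda>i. \<phi> (w i)))))"
    by (subst sum.swap) (simp add: sum_distrib_left)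
  also have "\<dots> = (\<Sum>w\<in>{..<2 * r} \<rightarrow>\<^sub>E A.
      if int p dvd alternating_sum (2 * r) (\<lambda>i. \<phi> (w i)) then of_nat p * (\<Prod>i<2 * r. d i (w i)) else 0)"
    by (intro sum.cong refl) (simp add: sum_e_char [OF assms(1)])
  also have "\<dots> = (\<Sum>w\<in>energy_tuples p (2 * r) A \<phi>. of_nat p * (\<Prod>i<2 * r. d i (w i)))"
    using assms by (simp add: energy_tuples_def sum.inter_filter finite_PiE)
  finally show ?thesis
    by (simp add: d_def sum_distrib_left)
qed

lemma even_moment_unweighted:
  assumes "p > 0" "finite A"
  shows "(\<Sum>l\<in>{0..<int p}. norm (\<Sum>x\<in>A. e_char p (l * \<phi> x)) ^ (2 * r))
       = real p * card (energy_tuples p (2 * r) A \<phi>)"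
proof -
  have "complex_of_real (\<Sum>l\<in>{0..<int p}. norm (\<Sum>x\<in>A. e_char p (l * \<phi> x)) ^ (2 * r))
      = complex_of_real (real p * card (energy_tuples p (2 * r) A \<phi>))"
    using even_moment_eq [OF assms, of "\<lambda>_. 1" \<phi> r] by (simp cong: if_cong)
  then show ?thesis by (simp only: of_real_eq_iff)
qed

text \<open>Orthogonality comes before the triangle inequality: only energy tuples survive, each
  with a product of \<open>2 * r\<close> weights of modulus at most \<open>B\<close>. Arbitrary
  weights thus cost no more than constant ones.\<close>

lemma even_moment_weighted_le:
  assumes "p > 0" "finite A" and c: "\<And>x. x \<in> A \<Longrightarrow> norm (c x) \<le> B"
  shows "(\<Sum>l\<in>{0..<int p}. norm (\<Sum>x\<in>A. c x * e_char p (l * \<phi> x)) ^ (2 * r))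
       \<le> B ^ (2 * r) * (real p * card (energy_tuples p (2 * r) A \<phi>))"
proof -
  let ?E = "energy_tuples p (2 * r) A \<phi>"
  let ?d = "\<lambda>w i. if even i then c (w i) else cnj (c (w i))"
  have "norm (\<Prod>i<2 * r. ?d w i) \<le> B ^ (2 * r)" if "w \<in> ?E" for w
  proof -
    have "norm (?d w i) \<le> B" if "i < 2 * r" for i
      using \<open>w \<in> ?E\<close> that by (auto simp: energy_tuples_def intro!: c)
    then have "(\<Prod>i<2 * r. norm (?d w i)) \<le> (\<Prod>i<2 * r. B)"
      by (intro prod_mono) auto
    then show ?thesis by (simp add: prod_norm [symmetric])
  qed
  then have "norm (\<Sum>w\<in>?E. \<Prod>i<2 * r. ?d w i) \<le> card ?E * B ^ (2 * r)"
    by (rule sum_norm_bound)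
  then have "norm (of_nat p * (\<Sum>w\<in>?E. \<Prod>i<2 * r. ?d w i)) \<le> B ^ (2 * r) * (real p * card ?E)"
    by (simp add: norm_mult mult_left_mono mult_ac)
  moreover have "(\<Sum>l\<in>{0..<int p}. norm (\<Sum>x\<in>A. c x * e_char p (l * \<phi> x)) ^ (2 * r)) \<le>
      norm (complex_of_real (\<Sum>l\<in>{0..<int p}. norm (\<Sum>x\<in>A. c x * e_char p (l * \<phi> x)) ^ (2 * r)))"
    unfolding norm_of_real by (rule abs_ge_self)
  ultimately show ?thesis
    unfolding even_moment_eq [OF assms(1,2)] by linarith
qed

section \<open>A power mean inequality with multiplicities\<close>

text \<open>Convexity of the \<open>n\<close>-th power at the points \<open>x i / \<rho> i\<close>
  with weights \<open>\<rho> i / R\<close> yields the divisor \<open>\<rho> i ^ (n - 1)\<close>,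
  which is weakened to \<open>\<rho> i\<close>. With \<open>\<rho>\<close> a fibre size, this
  divisor makes each fibre count once; with \<open>\<rho> = 1\<close> the lemma is the usual
  consequence of Hoelder's inequality.\<close>

lemma weighted_sum_power_le:
  fixes x \<rho> :: "'a \<Rightarrow> real"
  assumes "finite I" and x: "\<And>i. i \<in> I \<Longrightarrow> x i \<ge> 0" and \<rho>: "\<And>i. i \<in> I \<Longrightarrow> \<rho> i \<ge> 1"
    and "n \<ge> 2"
  shows "(\<Sum>i\<in>I. x i) ^ n \<le> (\<Sum>i\<in>I. \<rho> i) ^ (n - 1) * (\<Sum>i\<in>I. x i ^ n / \<rho> i)"
proof (cases "I = {}")
  case False
  define R where "R = (\<Sum>i\<in>I. \<rho> i)"
  have \<rho>0: "\<rho> i > 0" if "i \<in> I" for i using \<rho> [OF that] by simp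
  have R: "R > 0" unfolding R_def using False assms(1) \<rho>0 by (intro sum_pos) auto
  have n: "n = Suc (n - 1)" using assms by simp
  have "(\<Sum>i\<in>I. (\<rho> i / R) *\<^sub>R (x i / \<rho> i)) ^ n \<le> (\<Sum>i\<in>I. (\<rho> i / R) * (x i / \<rho> i) ^ n)"
  proof (rule convex_on_sum [where f = "\<lambda>t. t ^ n" and C = "{0..}"])
    show "convex_on {0::real..} (\<lambda>t. t ^ n)"
      using convex_power_odd [of n] convex_on_subset [OF convex_power_even [of n], of "{0..}"]
      by (cases "even n") auto
    show "(\<Sum>i\<in>I. \<rho> i / R) = 1" using R by (simp add: R_def sum_divide_distrib [symmetric])
    show "\<rho> i / R \<ge> 0" "x i / \<rho> i \<in> {0..}" if "i \<in> I" for i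
      using x [OF that] \<rho>0 [OF that] R by simp_all
  qed (use False assms(1) in auto)
  also have "(\<Sum>i\<in>I. (\<rho> i / R) *\<^sub>R (x i / \<rho> i)) = (\<Sum>i\<in>I. x i / R)"
  proof (rule sum.cong [OF refl])
    fix i assume "i \<in> I"
    with \<rho>0 show "(\<rho> i / R) *\<^sub>R (x i / \<rho> i) = x i / R" by fastforce
  qed
  also have "\<dots> = (\<Sum>i\<in>I. x i) / R"
    by (simp add: sum_divide_distrib)
  also have "(\<Sum>i\<in>I. (\<rho> i / R) * (x i / \<rho> i) ^ n) \<le> (\<Sum>i\<in>I. (x i ^ n / \<rho> i) / R)"
  proof (rule sum_mono)
    fix i assume i: "i \<in> I"
    have "\<rho> i ^ 2 \<le> \<rho> i ^ n" using \<rho> [OF i] \<open>n \<ge> 2\<close> by (rule power_increasing [rotated])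
    then have "\<rho> i * x i ^ n / \<rho> i ^ n \<le> \<rho> i * x i ^ n / \<rho> i ^ 2"
      using x [OF i] \<rho>0 [OF i] by (intro divide_left_mono) auto
    also have "\<dots> = x i ^ n / \<rho> i"
      using \<rho>0 [OF i] by (simp add: power2_eq_square)
    finally show "(\<rho> i / R) * (x i / \<rho> i) ^ n \<le> (x i ^ n / \<rho> i) / R"
      using R divide_right_mono [of "\<rho> i * x i ^ n / \<rho> i ^ n" "x i ^ n / \<rho> i" R]
      by (simp add: power_divide mult_ac)
  qed
  also have "\<dots> = (\<Sum>i\<in>I. x i ^ n / \<rho> i) / R"
    by (simp add: sum_divide_distrib)
  finally have "(\<Sum>i\<in>I. x i) ^ n / R ^ n * R ^ n \<le> (\<Sum>i\<in>I. x i ^ n / \<rho> i) / R * R ^ n"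
    using R by (intro mult_right_mono) (auto simp: power_divide)
  also have "R ^ n = R * R ^ (n - 1)" using n by (metis power_Suc)
  finally show ?thesis using R by (simp add: R_def [symmetric] mult_ac)
qed (use assms in \<open>simp add: power_0_left\<close>)

subsection \<open>Reciprocals modulo a prime\<close>

text \<open>Lagrange's bound for roots modulo a prime. Nonvanishing of \<open>Q\<close> modulo
  \<open>p\<close> is certified by one value \<open>a\<close>, and the same \<open>a\<close> still
  certifies the quotient after a root has been divided out.\<close>

lemma card_roots_mod_prime_le:
  fixes Q :: "int poly"
  assumes "prime p" "\<not> int p dvd poly Q a"
  shows "card {x \<in> {0..<int p}. int p dvd poly Q x} \<le> degree Q"
  using assms(2)
proof (induction "degree Q" arbitrary: Q a)
  case 0
  then obtain c where "Q = [:c:]" by (metis degree_eq_zeroE)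
  with 0 show ?case by simp
next
  case (Suc n)
  have p: "prime (int p)" using assms(1) by simp
  show ?case
  proof (cases "\<exists>b\<in>{0..<int p}. int p dvd poly Q b")
    case True
    then obtain b where b: "int p dvd poly Q b" by blast
    \<comment> \<open>Division takes place over the integers, so the remainder
      \<open>poly Q b\<close> is only divisible by \<open>p\<close> and need not be zero.\<close>
    define R where "R = synthetic_div Q b"
    have QR: "poly Q x = (x - b) * poly R x + poly Q b" for x
      using arg_cong [OF synthetic_div_correct' [of b Q], of "\<lambda>P. poly P x"]
      by (simp add: R_def algebra_simps)
    have deg: "n = degree R"
      using Suc.hyps(2) by (simp add: R_def degree_synthetic_div)
    have "\<not> int p dvd poly R a"
      using Suc.prems QR [of a] b by (metis dvd_add dvd_mult)
    then have IH: "card {x \<in> {0..<int p}. int p dvd poly R x} \<le> degree R"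
      using Suc.hyps(1) [OF deg] by blast
    have "{x \<in> {0..<int p}. int p dvd poly Q x} \<subseteq>
        insert (b mod int p) {x \<in> {0..<int p}. int p dvd poly R x}"
    proof (intro subsetI insertCI)
      fix x assume x: "x \<in> {x \<in> {0..<int p}. int p dvd poly Q x}"
        and nR: "x \<notin> {x \<in> {0..<int p}. int p dvd poly R x}"
      have "int p dvd (x - b) * poly R x"
        using x b QR [of x] by (metis (mono_tags, lifting) dvd_add_left_iff mem_Collect_eq)
      then have "int p dvd x - b"
        using x nR p by (auto simp: prime_dvd_mult_iff)
      then have "x mod int p = b mod int p"
        by (simp add: mod_eq_dvd_iff)
      with x show "x = b mod int p" by simp
    qed
    then have "card {x \<in> {0..<int p}. int p dvd poly Q x} \<le>
        card (insert (b mod int p) {x \<in> {0..<int p}. int p dvd poly R x})"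
      by (intro card_mono finite.insertI finite_Collect_conjI) auto
    also have "\<dots> \<le> Suc (card {x \<in> {0..<int p}. int p dvd poly R x})"
      by (rule card_insert_le_m1 [of "Suc _", simplified]) simp_all
    finally show ?thesis
      using IH deg Suc.hyps(2) by simp
  next
    case False
    then have "{x \<in> {0..<int p}. int p dvd poly Q x} = {}" by blast
    then show ?thesis by (simp only: card.empty)
  qed
qed

text \<open>
  Unlike \<^const>\<open>modular_inverse\<close>, the Fermat form is multiplicative on all integers without
  reduction; both vanish modulo \<open>p\<close> at multiples of \<open>p\<close> when \<open>p > 2\<close>.
\<close>

definition recip :: "nat \<Rightarrow> int \<Rightarrow> int" where
  "recip p x = x ^ (p - 2)"

lemma recip_mult: "recip p (x * y) = recip p x * recip p y"
  by (simp add: recip_def power_mult_distrib)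

lemma recip_cong: "[x = y] (mod int p) \<Longrightarrow> [recip p x = recip p y] (mod int p)"
  by (simp add: recip_def cong_pow)

lemma mult_recip_cong_1:
  assumes "prime p" "p > 2" "\<not> int p dvd x"
  shows "[x * recip p x = 1] (mod int p)"
proof -
  define y where "y = nat (x mod int p)"
  have y: "int y = x mod int p"
    using assms by (simp add: y_def)
  have "\<not> p dvd y"
    using assms(3) y by (metis dvd_mod_iff dvd_refl int_dvd_int_iff)
  then have "[y ^ (p - 1) = 1] (mod p)"
    using assms(1) by (intro fermat_theorem)
  then have "[int y ^ (p - 1) = 1] (mod int p)"
    by (metis cong_int_iff of_nat_1 of_nat_power)
  moreover have "[int y ^ (p - 1) = x ^ (p - 1)] (mod int p)"
    by (intro cong_pow) (simp add: y)
  moreover have "x ^ (p - 1) = x * recip p x"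
  proof -
    have "p - 1 = Suc (p - 2)" using assms(2) by simp
    then show ?thesis by (simp only: recip_def power_Suc)
  qed
  ultimately show ?thesis
    by (metis cong_sym cong_trans)
qed

lemma modular_inverse_cong_recip:
  assumes "prime p" "p > 2"
  shows "[modular_inverse (int p) x = recip p x] (mod int p)"
proof (cases "int p dvd x")
  case True
  then have "modular_inverse (int p) x = 0"
    using assms by (auto simp: modular_inverse_def)
  moreover have "int p dvd recip p x"
    using True assms(2) unfolding recip_def by (intro dvd_trans [OF True] dvd_power) auto
  ultimately show ?thesis
    by (metis cong_0_iff cong_sym)
next
  case False
  have "coprime x (int p)"
    using False assms(1) by (metis coprime_commute prime_imp_coprime prime_nat_int_transfer)
  then have "[modular_inverse (int p) x * x * recip p x = 1 * recip p x] (mod int p)"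
    by (intro cong_mult cong_modular_inverse2 cong_refl)
  moreover have "[modular_inverse (int p) x * (x * recip p x) = modular_inverse (int p) x * 1] (mod int p)"
    using mult_recip_cong_1 [OF assms False] by (intro cong_mult cong_refl)
  ultimately show ?thesis
    by (simp add: mult.assoc) (metis cong_sym cong_trans)
qed

lemma recip_not_dvd:
  assumes "prime p" "\<not> int p dvd x"
  shows "\<not> int p dvd recip p x"
  using assms unfolding recip_def by (metis prime_dvd_power prime_nat_int_transfer)

lemma recip_inj_mod:
  assumes "prime p" "p > 2" "\<not> int p dvd x" "\<not> int p dvd y" "[recip p x = recip p y] (mod int p)"
  shows "[x = y] (mod int p)"
proof -
  have "[x * recip p y * y = x * (y * recip p y)] (mod int p)"
    by (simp add: mult_ac)
  also have "[x * (y * recip p y) = x * 1] (mod int p)"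
    by (intro cong_mult cong_refl mult_recip_cong_1 assms)
  finally have 1: "[x * recip p y * y = x] (mod int p)" by simp
  have "[x * recip p y * y = x * recip p x * y] (mod int p)"
    by (intro cong_mult cong_refl cong_sym [OF assms(5)])
  also have "[x * recip p x * y = 1 * y] (mod int p)"
    by (intro cong_mult cong_refl mult_recip_cong_1 assms)
  finally show ?thesis using 1 by (metis cong_sym cong_trans mult_1)
qed

text \<open>Clearing denominators turns a zero into a root of a polynomial of degree at most
  \<open>n\<close>, which a pole belonging to a single index keeps from vanishing modulo
  \<open>p\<close>. The bound adds at most \<open>n\<close> such roots to at most \<open>n\<close>
  poles.\<close>

lemma card_zeros_alternating_recip_sum_le:
  fixes w :: "nat \<Rightarrow> int"
  assumes p: "prime p" "p > 2" and i: "i < n"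
    and unique: "\<And>j. \<lbrakk>j < n; j \<noteq> i\<rbrakk> \<Longrightarrow> \<not> int p dvd w j - w i"
  shows "card {\<mu> \<in> {0..<int p}. int p dvd alternating_sum n (\<lambda>j. recip p (\<mu> + w j))} \<le> 2 * n"
proof -
  \<comment> \<open>The numerator of the alternating sum of the fractions
    \<open>1 / (x + w j)\<close> over their common denominator.\<close>
  define Q where "Q = (\<Sum>j<n. Polynomial.smult ((- 1) ^ j) (\<Prod>k\<in>{..<n} - {j}. [:w k, 1:]))"
  have poly_Q: "poly Q x = (\<Sum>j<n. (- 1) ^ j * (\<Prod>k\<in>{..<n} - {j}. x + w k))" for x
    by (simp add: Q_def poly_sum poly_prod add.commute)
  have deg: "degree Q \<le> n"
  proof -
    have "degree (Polynomial.smult ((- 1) ^ j) (\<Prod>k\<in>{..<n} - {j}. [:w k, 1:])) \<le> n" if "j < n" for j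
    proof -
      have "degree (\<Prod>k\<in>{..<n} - {j}. [:w k, 1:]) \<le> (\<Sum>k\<in>{..<n} - {j}. degree [:w k, 1:])"
        by (rule order_trans [OF degree_prod_sum_le]) simp_all
      also have "\<dots> \<le> n" using that by simp
      finally show ?thesis by (meson degree_smult_le le_trans)
    qed
    then show ?thesis unfolding Q_def by (intro degree_sum_le) auto
  qed
  have pint: "prime (int p)" using p by simp
  (* Q is nonzero modulo p because only the i-th summand survives at the pole - w i. *)
  have "poly Q (- w i) = (- 1) ^ i * (\<Prod>k\<in>{..<n} - {i}. w k - w i)"
  proof -
    have "(\<Sum>j\<in>{..<n} - {i}. (- 1) ^ j * (\<Prod>k\<in>{..<n} - {j}. - w i + w k)) = 0"
    proof (rule sum.neutral, rule ballI)
      fix j assume "j \<in> {..<n} - {i}"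
      then have "(\<Prod>k\<in>{..<n} - {j}. - w i + w k) = 0"
        using i by (intro prod_zero) (auto intro: bexI [of _ i])
      then show "(- 1) ^ j * (\<Prod>k\<in>{..<n} - {j}. - w i + w k) = 0" by simp
    qed
    then show ?thesis
      unfolding poly_Q using i by (subst sum.remove [of _ i]) auto
  qed
  moreover have "\<not> int p dvd (\<Prod>k\<in>{..<n} - {i}. w k - w i)"
    using unique pint by (auto simp: prime_dvd_prod_iff)
  ultimately have "\<not> int p dvd poly Q (- w i)"
    by (cases "even i") auto
  then have roots: "card {x \<in> {0..<int p}. int p dvd poly Q x} \<le> n"
    using card_roots_mod_prime_le [OF p(1)] deg le_trans by blast
  \<comment> \<open>At a pole \<open>recip\<close> is zero modulo \<open>p\<close> and denominators
    cannot be cleared, so the residues of the \<open>- w j\<close> are set aside as possible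
    exceptions.\<close>
  have "{\<mu> \<in> {0..<int p}. int p dvd alternating_sum n (\<lambda>j. recip p (\<mu> + w j))} \<subseteq>
      {x \<in> {0..<int p}. int p dvd poly Q x} \<union> (\<lambda>j. (- w j) mod int p) ` {..<n}"
  proof (rule subsetI, rule UnCI)
    fix \<mu> assume \<mu>: "\<mu> \<in> {\<mu> \<in> {0..<int p}. int p dvd alternating_sum n (\<lambda>j. recip p (\<mu> + w j))}"
      and nopole: "\<mu> \<notin> (\<lambda>j. (- w j) mod int p) ` {..<n}"
    have unit: "\<not> int p dvd \<mu> + w j" if "j < n" for j
    proof
      assume "int p dvd \<mu> + w j"
      then have "\<mu> mod int p = (- w j) mod int p" by (simp add: mod_eq_dvd_iff)
      with \<mu> nopole that show False by auto
    qed
    define P where "P = (\<Prod>k<n. \<mu> + w k)"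
    have "[P * alternating_sum n (\<lambda>j. recip p (\<mu> + w j)) = poly Q \<mu>] (mod int p)"
    proof -
      have "[P * ((- 1) ^ j * recip p (\<mu> + w j)) = (- 1) ^ j * (\<Prod>k\<in>{..<n} - {j}. \<mu> + w k)] (mod int p)"
        if j: "j < n" for j
      proof -
        have "P = (\<mu> + w j) * (\<Prod>k\<in>{..<n} - {j}. \<mu> + w k)"
          unfolding P_def using j by (subst prod.remove [of _ j]) auto
        then have "P * ((- 1) ^ j * recip p (\<mu> + w j)) =
            ((- 1) ^ j * (\<Prod>k\<in>{..<n} - {j}. \<mu> + w k)) * ((\<mu> + w j) * recip p (\<mu> + w j))"
          by (simp add: mult_ac)
        also have "[\<dots> = ((- 1) ^ j * (\<Prod>k\<in>{..<n} - {j}. \<mu> + w k)) * 1] (mod int p)"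
          by (intro cong_mult cong_refl mult_recip_cong_1 p unit j)
        finally show ?thesis by simp
      qed
      then show ?thesis
        unfolding alternating_sum_def poly_Q sum_distrib_left by (intro cong_sum) auto
    qed
    then show "\<mu> \<in> {x \<in> {0..<int p}. int p dvd poly Q x}"
      using \<mu> by (auto simp: cong_dvd_iff [symmetric])
  qed
  then have "card {\<mu> \<in> {0..<int p}. int p dvd alternating_sum n (\<lambda>j. recip p (\<mu> + w j))} \<le>
      card ({x \<in> {0..<int p}. int p dvd poly Q x} \<union> (\<lambda>j. (- w j) mod int p) ` {..<n})"
    by (intro card_mono finite_UnI finite_Collect_conjI) auto
  also have "\<dots> \<le> card {x \<in> {0..<int p}. int p dvd poly Q x} + card ((\<lambda>j. (- w j) mod int p) ` {..<n})"
    by (rule card_Un_le)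
  also have "\<dots> \<le> n + n"
    using roots card_image_le [of "{..<n}" "\<lambda>j. (- w j) mod int p"] by (intro add_mono) auto
  finally show ?thesis by simp
qed

section \<open>Tuples with few distinct entries\<close>

text \<open>Every fibre has at least two elements. The contrapositive is what matters: a
  \<open>2 * r\<close>-tuple with more than \<open>r\<close> distinct values has an entry that
  occurs only once.\<close>

lemma card_image_le_half_if_repeated:
  fixes w :: "'a \<Rightarrow> 'b"
  assumes "finite I" "\<And>i. i \<in> I \<Longrightarrow> \<exists>j\<in>I. j \<noteq> i \<and> w j = w i"
  shows "2 * card (w ` I) \<le> card I"
proof -
  have "2 \<le> card {j \<in> I. w j = b}" if b: "b \<in> w ` I" for b
  proof -
    obtain i where i: "i \<in> I" "w i = b"
      using b by blast
    moreover obtain j where "j \<in> I" "j \<noteq> i" "w j = w i"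
      using assms(2) [OF i(1)] by auto
    ultimately have "card {i, j} \<le> card {j \<in> I. w j = b}"
      using assms(1) by (intro card_mono) auto
    with \<open>j \<noteq> i\<close> show ?thesis by simp
  qed
  then have "(\<Sum>b\<in>w ` I. 2) \<le> (\<Sum>b\<in>w ` I. card {j \<in> I. w j = b})"
    by (intro sum_mono) auto
  also have "\<dots> = card I"
    using sum.image_gen [OF assms(1), of "\<lambda>_. 1::nat" w] by simp
  finally show ?thesis by simp
qed

text \<open>Such a tuple factors as \<open>g\<close> after \<open>h\<close>, where \<open>h\<close>
  sends positions to \<open>r\<close> labels and \<open>g\<close> sends labels to \<open>A\<close>;
  the bound counts the pairs \<open>(g, h)\<close>.\<close>

lemma card_tuples_small_image_le:
  assumes "finite A" "n > 0"
  shows "card {w \<in> {..<n} \<rightarrow>\<^sub>E A. card (w ` {..<n}) \<le> r} \<le> card A ^ r * r ^ n"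
proof -
  let ?W = "{w \<in> {..<n} \<rightarrow>\<^sub>E A. card (w ` {..<n}) \<le> r}"
  let ?c = "\<lambda>(g, h). \<lambda>i\<in>{..<n}. (g :: nat \<Rightarrow> 'a) (h i :: nat)"
  have "?W \<subseteq> ?c ` (({..<r} \<rightarrow>\<^sub>E A) \<times> ({..<n} \<rightarrow>\<^sub>E {..<r}))"
  proof
    fix w assume w: "w \<in> ?W"
    define B where "B = w ` {..<n}"
    have B: "finite B" "card B \<le> r" "B \<subseteq> A" "B \<noteq> {}"
      using w \<open>n > 0\<close> by (auto simp: B_def)
    obtain e where e: "bij_betw e {..<card B} B"
      using B(1) ex_bij_betw_nat_finite [of B] by (auto simp: atLeast0LessThan)
    obtain b where b: "b \<in> B" using B by blast
    \<comment> \<open>Labels beyond the size of the image are padded with an arbitrary element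
      \<open>b\<close>, which exists because \<open>n > 0\<close>.\<close>
    define g where "g = (\<lambda>j\<in>{..<r}. if j < card B then e j else b)"
    define h where "h = (\<lambda>i\<in>{..<n}. the_inv_into {..<card B} e (w i))"
    have h: "h i < card B" "e (h i) = w i" if "i < n" for i
    proof -
      have "w i \<in> B" using that by (auto simp: B_def)
      then show "h i < card B" "e (h i) = w i"
        using that e the_inv_into_into [of e "{..<card B}" "w i" "{..<card B}"]
          f_the_inv_into_f_bij_betw [of e "{..<card B}" B "w i"]
        by (auto simp: h_def bij_betw_def)
    qed
    have "g \<in> {..<r} \<rightarrow>\<^sub>E A"
    proof -
      have "e j \<in> A" if "j < card B" for j
        using that e B(3) by (auto simp: bij_betw_def)
      moreover have "b \<in> A" using b B by blast
      ultimately show ?thesis by (auto simp: g_def)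
    qed
    moreover have "h \<in> {..<n} \<rightarrow>\<^sub>E {..<r}"
      using h(1) B(2) by (auto simp: h_def intro: less_le_trans)
    moreover have "w = ?c (g, h)"
    proof
      fix i show "w i = ?c (g, h) i"
      proof (cases "i < n")
        case True
        with h [OF True] B(2) show ?thesis by (simp add: g_def)
      next
        case False
        moreover have "w \<in> {..<n} \<rightarrow>\<^sub>E A" using w by simp
        ultimately have "w i = undefined"
          using PiE_arb [of w "{..<n}" "\<lambda>_. A" i] by simp
        with False show ?thesis by simp
      qed
    qed
    ultimately show "w \<in> ?c ` (({..<r} \<rightarrow>\<^sub>E A) \<times> ({..<n} \<rightarrow>\<^sub>E {..<r}))"
      by (intro image_eqI [where x = "(g, h)"] SigmaI)
  qed
  then have "card ?W \<le> card (({..<r} \<rightarrow>\<^sub>E A) \<times> ({..<n} \<rightarrow>\<^sub>E {..<r}))"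
    by (rule surj_card_le [rotated]) (simp add: assms finite_PiE)
  then show ?thesis by (simp add: card_cartesian_product card_PiE)
qed

subsection \<open>Counting proportional pairs\<close>

text \<open>Offsets from the minimum are multiples of \<open>b\<close> between \<open>0\<close> and
  \<open>n\<close>, so dividing them by \<open>b\<close> is injective into
  \<open>{0..int n div b}\<close>.\<close>

lemma card_spaced_le:
  fixes X :: "int set"
  assumes X: "X \<subseteq> {c + 1..c + int n}" and b: "b > 0"
    and spaced: "\<And>x y. \<lbrakk>x \<in> X; y \<in> X\<rbrakk> \<Longrightarrow> b dvd x - y"
  shows "real (card X) \<le> real n / of_int b + 1"
proof (cases "X = {}")
  case False
  have fin: "finite X" using X by (rule finite_subset) simp
  define m where "m = Min X"
  have m: "m \<in> X" "\<And>x. x \<in> X \<Longrightarrow> m \<le> x"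
    using fin False by (auto simp: m_def)
  have "inj_on (\<lambda>x. (x - m) div b) X"
  proof (rule inj_onI)
    fix x y assume xy: "x \<in> X" "y \<in> X" "(x - m) div b = (y - m) div b"
    have "b dvd x - m" "b dvd y - m" using spaced xy m by blast+
    with xy(3) have "x - m = y - m" by (metis dvd_div_mult_self)
    then show "x = y" by simp
  qed
  moreover have "(\<lambda>x. (x - m) div b) ` X \<subseteq> {0..int n div b}"
  proof
    fix y assume "y \<in> (\<lambda>x. (x - m) div b) ` X"
    then obtain x where x: "x \<in> X" "y = (x - m) div b" by blast
    have "c + 1 \<le> m" "x \<le> c + int n" using m(1) x(1) X by auto
    then have "0 \<le> x - m" "x - m \<le> int n" using m(2) [OF x(1)] by simp_all
    then show "y \<in> {0..int n div b}"
      using x b by (simp add: pos_imp_zdiv_nonneg_iff zdiv_mono1)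
  qed
  ultimately have "card X \<le> card {0..int n div b}"
    by (rule card_inj_on_le) simp
  also have "card {0..int n div b} = nat (int n div b + 1)"
    by simp
  finally have "int (card X) \<le> int n div b + 1"
    using b pos_imp_zdiv_nonneg_iff [of b "int n"] by linarith
  then have "real (card X) \<le> of_int (int n div b) + 1"
    by linarith
  also have "of_int (int n div b) \<le> real n / of_int b"
    using floor_divide_of_int_eq [of "int n" b, where 'a = real] by linarith
  finally show ?thesis by simp
qed (use b in simp)

text \<open>The interval may lie anywhere, so a solution need not satisfy an integer equation, but
  the difference of two solutions is small enough to do so. Hence \<open>l\<close> determines
  \<open>k\<close>, and the admissible \<open>l\<close> differ by multiples of
  \<open>v / gcd u v\<close>.\<close>

lemma card_proportional_pairs_le:
  fixes u v :: nat
  assumes "0 < u" "u \<le> U" "0 < v" "v \<le> U" and small: "2 * U * n \<le> p"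
  shows "real (card {(k, l). k \<in> {c + 1..c + int n} \<and> l \<in> {c + 1..c + int n} \<and>
            int p dvd k * int v - l * int u})
       \<le> real n * (real (gcd u v) / real v) + 1"
proof (cases "n = 0")
  case False
  define I where "I = {c + 1..c + int n}"
  define T where "T = {(k, l). k \<in> I \<and> l \<in> I \<and> int p dvd k * int v - l * int u}"
  have eq: "(k - k') * int v = (l - l') * int u" if "(k, l) \<in> T" "(k', l') \<in> T" for k l k' l'
  proof -
    define t where "t = (k - k') * int v - (l - l') * int u"
    have "int p dvd (k * int v - l * int u) - (k' * int v - l' * int u)"
      using that by (intro dvd_diff [of "int p" "_ - _"]) (auto simp: T_def)
    then have dvd: "int p dvd t" by (simp add: t_def algebra_simps)
    have kl: "\<bar>k - k'\<bar> \<le> int n - 1" "\<bar>l - l'\<bar> \<le> int n - 1"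
      using that by (auto simp: T_def I_def)
    have "\<bar>t\<bar> \<le> \<bar>k - k'\<bar> * int v + \<bar>l - l'\<bar> * int u"
      unfolding t_def by (rule order_trans [OF abs_triangle_ineq4]) (simp add: abs_mult)
    \<comment> \<open>Differences within the interval are at most \<open>n - 1\<close>; this is what
      makes the comparison with \<open>2 * U * n\<close> strict, so that a multiple of
      \<open>p\<close> must vanish.\<close>
    also have "\<dots> \<le> (int n - 1) * int U + (int n - 1) * int U"
      using kl assms by (intro add_mono mult_mono) auto
    also have "\<dots> < 2 * int U * int n"
      using assms by (simp add: algebra_simps)
    also have "\<dots> \<le> int p"
      using small by (metis of_nat_le_iff of_nat_mult of_nat_numeral)
    finally have "t = 0"
      using dvd by (metis abs_of_nat dvd_imp_le_int linorder_not_less)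
    then show ?thesis by (simp add: t_def)
  qed
  define g where "g = gcd u v"
  obtain u' v' where uv: "u = g * u'" "v = g * v'" "coprime u' v'"
    unfolding g_def by (metis gcd_coprime_exists assms(1) gcd_eq_0_iff mult.commute neq0_conv)
  have pos: "g > 0" "v' > 0" using uv assms by auto
  have "inj_on snd T"
  proof (rule inj_onI, clarsimp)
    fix k k' l assume "(k, l) \<in> T" "(k', l) \<in> T"
    from eq [OF this] show "k = k'" using assms by simp
  qed
  then have "card T = card (snd ` T)" by (simp add: card_image)
  moreover have "real (card (snd ` T)) \<le> real n / of_int (int v') + 1"
  proof (rule card_spaced_le)
    show "snd ` T \<subseteq> {c + 1..c + int n}" by (auto simp: T_def I_def)
    fix l l' assume "l \<in> snd ` T" "l' \<in> snd ` T"
    then obtain k k' where "(k, l) \<in> T" "(k', l') \<in> T" by auto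
    from eq [OF this] have "(k - k') * int v' = (l - l') * int u'"
      using uv pos by simp
    then have "int v' dvd (l - l') * int u'" by (metis dvd_triv_right)
    moreover have "coprime (int v') (int u')" using uv by (simp add: coprime_commute)
    ultimately show "int v' dvd l - l'" by (simp add: coprime_dvd_mult_left_iff)
  qed (use pos in simp)
  moreover have "real n / of_int (int v') = real n * (real (gcd u v) / real v)"
    unfolding g_def [symmetric] using pos by (simp add: uv(2))
  ultimately show ?thesis by (simp add: T_def I_def)
qed simp

text \<open>Writing \<open>u = g * a\<close> and \<open>v = g * b\<close> with \<open>g\<close> the
  gcd turns the summand into \<open>1 / b\<close>. Forgetting the coprimality of \<open>a\<close>
  and \<open>b\<close>, the sum over \<open>a\<close> contributes at most \<open>U / g\<close>, and
  the sums over \<open>g\<close> and \<open>b\<close> give one harmonic factor each.\<close>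

lemma sum_gcd_ratio_le:
  "(\<Sum>u\<in>{1..U}. \<Sum>v\<in>{1..U}. real (gcd u v) / real v) \<le> real U * harm U ^ 2"
proof -
  \<comment> \<open>Letting \<open>b\<close> run up to \<open>U\<close> instead of
    \<open>U div g\<close> only enlarges the sum and makes the inner sum over \<open>b\<close>
    independent of \<open>g\<close>.\<close>
  define S where "S = (SIGMA g:{1..U}. {1..U div g} \<times> {1..U})"
  have "(\<Sum>(u, v)\<in>{1..U} \<times> {1..U}. real (gcd u v) / real v) \<le> (\<Sum>(g, a, b)\<in>S. 1 / real b)"
  proof (rule sum_le_included [where i = "\<lambda>(g, a, b). (g * a, g * b)"])
    show "\<forall>x\<in>{1..U} \<times> {1..U}. \<exists>y\<in>S. (\<lambda>(g, a, b). (g * a, g * b)) y = x \<and>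
        (\<lambda>(u, v). real (gcd u v) / real v) x \<le> (\<lambda>(g, a, b). 1 / real b) y"
    proof clarify
      fix u v assume uv: "u \<in> {1..U}" "v \<in> {1..U}"
      define g where "g = gcd u v"
      obtain a b where ab: "u = g * a" "v = g * b"
        unfolding g_def by (metis gcd_dvd1 gcd_dvd2 dvdE)
      have pos: "g > 0" "a > 0" "b > 0" using uv ab by auto
      have "g \<le> g * a" "b \<le> g * b" "a \<le> U div g"
        using pos uv ab by (simp_all add: less_eq_div_iff_mult_less_eq mult.commute)
      moreover have "g * a \<le> U" "g * b \<le> U" using uv ab by simp_all
      ultimately have "g \<le> U" "b \<le> U" by linarith+
      with \<open>a \<le> U div g\<close> pos have "(g, a, b) \<in> S" by (simp add: S_def)
      moreover have "real (gcd u v) / real v = 1 / real b"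
        unfolding g_def [symmetric] using pos by (simp add: ab(2))
      ultimately show "\<exists>y\<in>S. (\<lambda>(g, a, b). (g * a, g * b)) y = (u, v) \<and>
          real (gcd u v) / real v \<le> (\<lambda>(g, a, b). 1 / real b) y"
        using ab by (intro bexI [of _ "(g, a, b)"]) auto
    qed
  qed (auto simp: S_def)
  also have "(\<Sum>(g, a, b)\<in>S. 1 / real b) = (\<Sum>g\<in>{1..U}. real (U div g) * harm U)"
    unfolding S_def
    by (subst sum.Sigma [symmetric], simp, simp, intro sum.cong refl)
      (simp add: sum.cartesian_product [symmetric] harm_def inverse_eq_divide)
  also have "\<dots> \<le> (\<Sum>g\<in>{1..U}. (real U / real g) * harm U)"
    by (intro sum_mono mult_right_mono of_nat_div_le_of_nat harm_nonneg)
  also have "\<dots> = real U * harm U ^ 2"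
    by (simp add: harm_def sum_distrib_right sum_distrib_left power2_eq_square divide_inverse mult_ac)
  finally show ?thesis by (simp add: sum.cartesian_product)
qed

section \<open>Averaging energies over shifts\<close>

lemma energy_tuples_cong:
  assumes "\<And>x. x \<in> A \<Longrightarrow> [\<phi> x = \<psi> x] (mod int p)"
  shows "energy_tuples p n A \<phi> = energy_tuples p n A \<psi>"
proof -
  have "[alternating_sum n (\<lambda>i. \<phi> (w i)) = alternating_sum n (\<lambda>i. \<psi> (w i))] (mod int p)"
    if "w \<in> {..<n} \<rightarrow>\<^sub>E A" for w
    unfolding alternating_sum_def using that
    by (intro cong_sum cong_mult cong_refl assms) auto
  then show ?thesis
    unfolding energy_tuples_def by (intro Collect_cong conj_cong refl cong_dvd_iff)
qed

lemma energy_tuples_mult_unit: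
  assumes "prime p" "\<not> int p dvd c"
  shows "energy_tuples p n A (\<lambda>x. c * \<phi> x) = energy_tuples p n A \<phi>"
proof -
  have "alternating_sum n (\<lambda>i. c * \<phi> (w i)) = c * alternating_sum n (\<lambda>i. \<phi> (w i))" for w
    by (simp add: alternating_sum_def sum_distrib_left mult_ac)
  then show ?thesis
    using assms by (auto simp: energy_tuples_def prime_dvd_mult_iff)
qed

text \<open>Collapses a sum over pairs \<open>(u, k)\<close>, divided by multiplicities, into a sum
  over the distinct quotients, which can then be extended to all residues.\<close>

lemma sum_div_card_fibre:
  fixes f :: "'b \<Rightarrow> real"
  assumes "finite A"
  shows "(\<Sum>x\<in>A. f (m x) / real (card {y \<in> A. m y = m x})) = (\<Sum>\<mu>\<in>m ` A. f \<mu>)"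
proof -
  have "(\<Sum>x\<in>A. f (m x) / real (card {y \<in> A. m y = m x})) =
      (\<Sum>\<mu>\<in>m ` A. \<Sum>x\<in>{x \<in> A. m x = \<mu>}. f \<mu> / real (card {y \<in> A. m y = \<mu>}))"
    by (subst sum.image_gen [OF assms, of _ m]) (intro sum.cong refl, auto)
  also have "\<dots> = (\<Sum>\<mu>\<in>m ` A. f \<mu>)"
  proof (rule sum.cong [OF refl])
    fix \<mu> assume "\<mu> \<in> m ` A"
    then have "card {x \<in> A. m x = \<mu>} > 0"
      using assms by (auto simp: card_gt_0_iff)
    then show "(\<Sum>x\<in>{x \<in> A. m x = \<mu>}. f \<mu> / real (card {y \<in> A. m y = \<mu>})) = f \<mu>"
      by simp
  qed
  finally show ?thesis .
qed

text \<open>After exchanging the order, the residues \<open>\<mu>\<close> are counted for each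
  tuple. Tuples with at most \<open>r\<close> distinct entries are rare and get the trivial count
  \<open>p\<close>; any other tuple has an entry occurring once, hence a simple pole and at most
  \<open>4 * r\<close> zeros.\<close>

lemma sum_card_energy_shifted_recip_le:
  assumes p: "prime p" "p > 2" and "r > 0" "V < p"
  shows "(\<Sum>\<mu>\<in>{0..<int p}. card (energy_tuples p (2 * r) {1..int V} (\<lambda>v. recip p (\<mu> + v))))
       \<le> p * (V ^ r * r ^ (2 * r)) + 4 * r * V ^ (2 * r)"
proof -
  define P where "P = {..<2 * r} \<rightarrow>\<^sub>E {1..int V}"
  define B where "B = {w \<in> P. card (w ` {..<2 * r}) \<le> r}"
  define Z where "Z w = {\<mu> \<in> {0..<int p}. int p dvd alternating_sum (2 * r) (\<lambda>i. recip p (\<mu> + w i))}" for w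
  have fin: "finite P" "finite B" by (auto simp: P_def B_def intro!: finite_PiE)
  have "(\<Sum>\<mu>\<in>{0..<int p}. card (energy_tuples p (2 * r) {1..int V} (\<lambda>v. recip p (\<mu> + v)))) =
      (\<Sum>\<mu>\<in>{0..<int p}. \<Sum>w\<in>P. if int p dvd alternating_sum (2 * r) (\<lambda>i. recip p (\<mu> + w i)) then 1 else 0)"
    using fin by (simp add: energy_tuples_def P_def [symmetric] sum.inter_filter [symmetric])
  also have "\<dots> = (\<Sum>w\<in>P. card (Z w))"
    by (subst sum.swap) (simp add: Z_def sum.inter_filter [symmetric])
  also have "\<dots> \<le> (\<Sum>w\<in>P. (if w \<in> B then p else 0) + 4 * r)"
  proof (rule sum_mono)
    fix w assume w: "w \<in> P"
    show "card (Z w) \<le> (if w \<in> B then p else 0) + 4 * r"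
    proof (cases "w \<in> B")
      case True
      have "card (Z w) \<le> card {0..<int p}"
        by (rule card_mono) (auto simp: Z_def)
      with True show ?thesis by simp
    next
      case False
      then have "\<not> 2 * card (w ` {..<2 * r}) \<le> card {..<2 * r}"
        using w by (simp add: B_def)
      then obtain i where i: "i < 2 * r" "\<And>j. \<lbrakk>j < 2 * r; j \<noteq> i\<rbrakk> \<Longrightarrow> w j \<noteq> w i"
        using card_image_le_half_if_repeated [of "{..<2 * r}" w] by blast
      \<comment> \<open>Since \<open>V < p\<close>, different entries stay different modulo
        \<open>p\<close>.\<close>
      have "\<not> int p dvd w j - w i" if "j < 2 * r" "j \<noteq> i" for j
      proof
        assume dvd: "int p dvd w j - w i"
        have "w i \<in> {1..int V}" "w j \<in> {1..int V}"
          using w i(1) that(1) unfolding P_def by (meson PiE_mem lessThan_iff)+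
        then have "\<bar>w j - w i\<bar> < int p" using \<open>V < p\<close> by auto
        with dvd have "w j - w i = 0" using zdvd_not_zless by (metis abs_of_nat dvd_imp_le_int linorder_not_less)
        with i(2) that show False by simp
      qed
      then have "card (Z w) \<le> 2 * (2 * r)"
        unfolding Z_def by (intro card_zeros_alternating_recip_sum_le [OF p i(1)])
      then show ?thesis by simp
    qed
  qed
  also have "\<dots> = p * card B + 4 * r * card P"
    using fin by (simp add: sum.distrib sum.inter_filter [symmetric] B_def mult.commute)
  also have "card P = V ^ (2 * r)"
    by (simp add: P_def card_PiE)
  also have "p * card B \<le> p * (V ^ r * r ^ (2 * r))"
    using card_tuples_small_image_le [of "{1..int V}" "2 * r" r] \<open>r > 0\<close>
    by (simp add: B_def P_def)
  finally show ?thesis by simp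
qed

lemma harm_le_1_plus_ln:
  assumes "n > 0"
  shows "harm n \<le> 1 + ln (real n)"
  using assms
proof (induction n)
  case (Suc n)
  show ?case
  proof (cases "n = 0")
    case False
    have "ln (real n / real (Suc n)) \<le> real n / real (Suc n) - 1"
      using False by (intro ln_le_minus_one) simp
    moreover have "real n / real (Suc n) - 1 = - inverse (real (Suc n))"
      by (simp add: field_simps)
    ultimately have "inverse (real (Suc n)) \<le> ln (real (Suc n)) - ln (real n)"
      using False by (simp add: ln_div)
    with Suc.IH False show ?thesis by (simp add: harm_Suc)
  qed (simp add: harm_expand)
qed simp

text \<open>Bounds the second moment of the multiplicities of the quotients \<open>k / u\<close>
  modulo \<open>p\<close>. The terms \<open>+ 1\<close> from the individual counts add up to
  \<open>U * U\<close>, which \<open>U \<le> n\<close> absorbs.\<close>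

lemma sum_card_proportional_le:
  assumes "2 * U * n \<le> p" "U \<le> n"
  shows "(\<Sum>x\<in>{1..U} \<times> {c + 1..c + int n}. real (card
            {y \<in> {1..U} \<times> {c + 1..c + int n}. int p dvd snd x * int (fst y) - snd y * int (fst x)}))
       \<le> real n * real U * (1 + harm U ^ 2)"
proof -
  define I where "I = {c + 1..c + int n}"
  define T where "T u v = {(k, l). k \<in> I \<and> l \<in> I \<and> int p dvd k * int v - l * int u}" for u v
  define f :: "nat \<Rightarrow> int \<Rightarrow> nat \<Rightarrow> int \<Rightarrow> real"
    where "f u k v l = (if int p dvd k * int v - l * int u then 1 else 0)" for u k v l
  have fin: "finite I" by (simp add: I_def)
  have "(\<Sum>x\<in>{1..U} \<times> I. real (card {y \<in> {1..U} \<times> I. int p dvd snd x * int (fst y) - snd y * int (fst x)}))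
      = (\<Sum>(u, k)\<in>{1..U} \<times> I. \<Sum>(v, l)\<in>{1..U} \<times> I. f u k v l)"
    unfolding f_def case_prod_unfold
    using fin by (simp add: sum.inter_filter [symmetric] del: mem_Sigma_iff)
  also have "\<dots> = (\<Sum>u\<in>{1..U}. \<Sum>k\<in>I. \<Sum>v\<in>{1..U}. \<Sum>l\<in>I. f u k v l)"
    by (simp only: sum.cartesian_product [symmetric])
  also have "\<dots> = (\<Sum>u\<in>{1..U}. \<Sum>v\<in>{1..U}. \<Sum>k\<in>I. \<Sum>l\<in>I. f u k v l)"
    by (rule sum.cong [OF refl], rule sum.swap)
  also have "\<dots> = (\<Sum>u\<in>{1..U}. \<Sum>v\<in>{1..U}. real (card (T u v)))"
  proof (intro sum.cong refl)
    fix u v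
    have T: "T u v = {x \<in> I \<times> I. int p dvd fst x * int v - snd x * int u}"
      by (auto simp: T_def)
    show "(\<Sum>k\<in>I. \<Sum>l\<in>I. f u k v l) = real (card (T u v))"
      unfolding T f_def sum.cartesian_product case_prod_unfold
      using fin by (simp add: sum.inter_filter [symmetric] del: mem_Sigma_iff)
  qed
  also have "\<dots> \<le> (\<Sum>u\<in>{1..U}. \<Sum>v\<in>{1..U}. real n * (real (gcd u v) / real v) + 1)"
    unfolding T_def I_def
    by (intro sum_mono card_proportional_pairs_le [OF _ _ _ _ assms(1)]) auto
  also have "\<dots> = real n * (\<Sum>u\<in>{1..U}. \<Sum>v\<in>{1..U}. real (gcd u v) / real v) + real U * real U"
    by (simp add: sum.distrib sum_distrib_left)
  also have "\<dots> \<le> real n * (real U * harm U ^ 2) + real n * real U"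
    using assms(2) by (intro add_mono mult_left_mono mult_right_mono sum_gcd_ratio_le) auto
  finally show ?thesis by (simp add: I_def algebra_simps)
qed

text \<open>
  Each solution in the original interval gives one in the shifted family for every choice of the
  shifts \<open>u v\<close>; this monotonicity replaces the usual completion of incomplete sums.
\<close>

lemma card_energy_shift_le:
  assumes "U > 0" "V > 0"
  shows "card (energy_tuples p n {c + 1..c + int K} (recip p)) * (U * V) ^ n
      \<le> card (energy_tuples p n
           (({1..U} \<times> {c - int (U * V) + 1..c - int (U * V) + int (K + U * V)}) \<times> {1..int V})
           (\<lambda>((u, k), v). recip p (k + int u * v)))"
proof -
  define I where "I = {c + 1..c + int K}"
  define I' where "I' = {c - int (U * V) + 1..c - int (U * V) + int (K + U * V)}"
  let ?E = "energy_tuples p n I (recip p)"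
  let ?E' = "energy_tuples p n (({1..U} \<times> I') \<times> {1..int V}) (\<lambda>((u, k), v). recip p (k + int u * v))"
  let ?P = "{..<n} \<rightarrow>\<^sub>E {1..U} \<times> {1..int V}"
  \<comment> \<open>The shifts \<open>t\<close> are free, and the base point
    \<open>w i - u * v\<close> is chosen so that adding \<open>u * v\<close> restores
    \<open>w i\<close>; the enlarged interval \<open>I'\<close> contains all these base
    points.\<close>
  let ?f = "\<lambda>(w, t). \<lambda>i\<in>{..<n}. ((fst (t i), w i - int (fst (t i)) * snd (t i)), snd (t i))"
  have "inj_on ?f (?E \<times> ?P)"
  proof (rule inj_onI)
    fix a b assume ab: "a \<in> ?E \<times> ?P" "b \<in> ?E \<times> ?P" "?f a = ?f b"
    obtain w t w' t' where eqs: "a = (w, t)" "b = (w', t')" by (metis surj_pair)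
    with ab have w: "w \<in> ?E" "w' \<in> ?E" and t: "t \<in> ?P" "t' \<in> ?P" and eq: "?f (w, t) = ?f (w', t')"
      by simp_all
    have *: "t i = t' i" "w i = w' i" if "i < n" for i
      using fun_cong [OF eq, of i] that by (auto simp: prod_eq_iff)
    have "w = w' \<and> t = t'"
      using w t * unfolding energy_tuples_def
      by (intro conjI; elim CollectE conjE; intro PiE_ext [of _ "{..<n}"]; simp)
    then show "a = b" by (simp add: eqs)
  qed
  moreover have "?f ` (?E \<times> ?P) \<subseteq> ?E'"
  proof (rule image_subsetI)
    fix a assume a: "a \<in> ?E \<times> ?P"
    obtain w t where eq: "a = (w, t)" by (cases a)
    with a have w: "w \<in> ?E" and t: "t \<in> ?P" by simp_all
    have "((fst (t i), w i - int (fst (t i)) * snd (t i)), snd (t i)) \<in> ({1..U} \<times> I') \<times> {1..int V}"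
      if "i < n" for i
    proof -
      obtain u v where uv: "t i = (u, v)" by fastforce
      have "t i \<in> {1..U} \<times> {1..int V}" "w i \<in> I"
        using w t that by (auto simp: energy_tuples_def)
      then have *: "u \<in> {1..U}" "v \<in> {1..int V}" "w i \<in> I" by (auto simp: uv)
      then have "0 \<le> int u * v" "int u * v \<le> int U * int V"
        by (auto intro!: mult_mono)
      moreover from this have "w i - int u * v \<in> I'"
        using *(3) by (simp add: I_def I'_def)
      ultimately show ?thesis using * by (simp add: uv)
    qed
    moreover have "alternating_sum n (\<lambda>i. (\<lambda>((u, k), v). recip p (k + int u * v)) (?f (w, t) i))
        = alternating_sum n (\<lambda>i. recip p (w i))"
      by (simp add: alternating_sum_def)
    ultimately show "?f a \<in> ?E'"
      using w unfolding eq energy_tuples_def by auto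
  qed
  moreover have "finite ?E'"
    by (intro finite_energy_tuples finite_cartesian_product) (auto simp: I'_def)
  ultimately have "card (?E \<times> ?P) \<le> card ?E'"
    by (rule card_inj_on_le)
  then show ?thesis
    by (simp add: card_cartesian_product card_PiE I_def I'_def)
qed

text \<open>Only \<open>u\<close> has to be a unit: \<open>recip\<close> is multiplicative and
  respects congruences, so the factorisation holds even if \<open>k + u * v\<close> is divisible by
  \<open>p\<close>.\<close>

lemma recip_shift_cong:
  assumes "prime p" "p > 2" "\<not> int p dvd u"
  shows "[recip p (k + u * v) = recip p u * recip p ((k * recip p u) mod int p + v)] (mod int p)"
proof -
  have "[u * (k * recip p u mod int p + v) = u * (k * recip p u + v)] (mod int p)"
    by (intro cong_mult cong_add cong_refl) simp
  also have "u * (k * recip p u + v) = k * (u * recip p u) + u * v"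
    by (simp add: algebra_simps)
  also have "[k * (u * recip p u) + u * v = k * 1 + u * v] (mod int p)"
    by (intro cong_mult cong_add cong_refl mult_recip_cong_1 assms)
  finally have "[k + u * v = u * (k * recip p u mod int p + v)] (mod int p)"
    by (simp add: cong_sym_eq)
  then have "[recip p (k + u * v) = recip p (u * (k * recip p u mod int p + v))] (mod int p)"
    by (rule recip_cong)
  then show ?thesis by (simp add: recip_mult)
qed

lemma quotient_cong_iff:
  assumes "prime p" "p > 2" "\<not> int p dvd u" "\<not> int p dvd v"
  shows "(k * recip p u) mod int p = (l * recip p v) mod int p \<longleftrightarrow> int p dvd k * v - l * u"
proof -
  have "(k * recip p u) mod int p = (l * recip p v) mod int p \<longleftrightarrow>
      int p dvd k * recip p u - l * recip p v"
    by (simp add: mod_eq_dvd_iff)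
  also have "\<dots> \<longleftrightarrow> int p dvd (u * v) * (k * recip p u - l * recip p v)"
    using assms by (simp add: prime_dvd_mult_iff)
  also have "[(u * v) * (k * recip p u - l * recip p v) = k * v * 1 - l * u * 1] (mod int p)"
  proof -
    have "(u * v) * (k * recip p u - l * recip p v) =
        k * v * (u * recip p u) - l * u * (v * recip p v)"
      by (simp add: algebra_simps)
    also have "[\<dots> = k * v * 1 - l * u * 1] (mod int p)"
      using mult_recip_cong_1 [OF assms(1,2,3)] mult_recip_cong_1 [OF assms(1,2,4)]
      by (intro cong_diff cong_scalar_left)
    finally show ?thesis .
  qed
  then have "int p dvd (u * v) * (k * recip p u - l * recip p v) \<longleftrightarrow> int p dvd k * v - l * u"
    using cong_dvd_iff by fastforce
  finally show ?thesis .
qed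

text \<open>The shifting argument with \<open>U\<close> and \<open>V\<close> still free. The
  condition on \<open>U * V\<close> keeps the enlarged interval within twice the length
  \<open>K\<close>, and the one on \<open>4 * U * K\<close> controls coincidences among the
  quotients \<open>k / u\<close>.\<close>

lemma energy_recip_interval_le:
  assumes p: "prime p" "p > 2" and "r > 0" "U > 0" "V > 0" "V < p"
    and UV: "U * V \<le> K" and UK: "4 * U * K \<le> p"
  shows "real (card (energy_tuples p (2 * r) {c + 1..c + int K} (recip p))) * real (U * V) ^ (2 * r)
       \<le> (2 * real K * real U * (1 + harm U ^ 2)) ^ (2 * r - 1) *
           (real p * (real V ^ r * real r ^ (2 * r)) + 4 * real r * real V ^ (2 * r))"
proof -
  define n where "n = K + U * V"
  define I where "I = {c - int (U * V) + 1..c - int (U * V) + int n}"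
  define L where "L = {1..U} \<times> I"
  define \<psi> where "\<psi> u k v = recip p (k + int u * v)" for u k v
  define m where "m = (\<lambda>(u, k). (k * recip p (int u)) mod int p)"
  define \<rho> where "\<rho> x = real (card {y \<in> L. m y = m x})" for x
  define E where "E \<mu> = real (card (energy_tuples p (2 * r) {1..int V} (\<lambda>v. recip p (\<mu> + v))))" for \<mu>
  define N where "N = (\<Sum>x\<in>L. \<rho> x)"
  have p0: "p > 0" using p by simp
  have finL: "finite L" by (simp add: L_def I_def)
  have "U \<le> U * V" using \<open>V > 0\<close> by simp
  then have "U \<le> K" "K > 0" using UV \<open>U > 0\<close> by linarith+
  then have "U \<le> U * K" by simp
  then have "U < p" using UK \<open>U > 0\<close> by linarith
  have n: "K \<le> n" "n \<le> 2 * K" using UV by (auto simp: n_def)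
  have unit: "\<not> int p dvd int u" if "u \<in> {1..U}" for u
    using that \<open>U < p\<close> by (auto dest: dvd_imp_le)

  have "real (card (energy_tuples p (2 * r) {c + 1..c + int K} (recip p)) * (U * V) ^ (2 * r)) \<le>
      real (card (energy_tuples p (2 * r) (L \<times> {1..int V}) (\<lambda>((u, k), v). \<psi> u k v)))"
    unfolding of_nat_le_iff L_def I_def n_def \<psi>_def
    by (rule card_energy_shift_le [OF \<open>U > 0\<close> \<open>V > 0\<close>])
  then have "real p * (real (card (energy_tuples p (2 * r) {c + 1..c + int K} (recip p))) * real (U * V) ^ (2 * r)) \<le>
      real p * real (card (energy_tuples p (2 * r) (L \<times> {1..int V}) (\<lambda>((u, k), v). \<psi> u k v)))"
    by (intro mult_left_mono) auto
  \<comment> \<open>The count is turned back into a moment, because the power mean inequality has to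
    be applied at each frequency \<open>d\<close> separately.\<close>
  also have "\<dots> = (\<Sum>d\<in>{0..<int p}.
      norm (\<Sum>x\<in>L \<times> {1..int V}. e_char p (d * (\<lambda>((u, k), v). \<psi> u k v) x)) ^ (2 * r))"
    using finL by (intro even_moment_unweighted [symmetric] p0) simp
  also have "\<dots> \<le> (\<Sum>d\<in>{0..<int p}. N ^ (2 * r - 1) *
      (\<Sum>x\<in>L. norm (\<Sum>v\<in>{1..int V}. e_char p (d * \<psi> (fst x) (snd x) v)) ^ (2 * r) / \<rho> x))"
  proof (rule sum_mono)
    fix d
    have "(\<Sum>x\<in>L \<times> {1..int V}. e_char p (d * (\<lambda>((u, k), v). \<psi> u k v) x)) =
        (\<Sum>x\<in>L. \<Sum>v\<in>{1..int V}. e_char p (d * \<psi> (fst x) (snd x) v))"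
      by (simp add: sum.cartesian_product case_prod_unfold)
    then have "norm (\<Sum>x\<in>L \<times> {1..int V}. e_char p (d * (\<lambda>((u, k), v). \<psi> u k v) x)) ^ (2 * r) \<le>
        (\<Sum>x\<in>L. norm (\<Sum>v\<in>{1..int V}. e_char p (d * \<psi> (fst x) (snd x) v))) ^ (2 * r)"
      by (intro power_mono) (auto intro: norm_sum)
    also have "\<dots> \<le> N ^ (2 * r - 1) *
      (\<Sum>x\<in>L. norm (\<Sum>v\<in>{1..int V}. e_char p (d * \<psi> (fst x) (snd x) v)) ^ (2 * r) / \<rho> x)"
      unfolding N_def
    proof (rule weighted_sum_power_le [OF finL])
      fix x assume "x \<in> L"
      then have "{y \<in> L. m y = m x} \<noteq> {}" by blast
      then have "card {y \<in> L. m y = m x} > 0"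
        using finL by (simp add: card_gt_0_iff)
      then show "\<rho> x \<ge> 1" by (simp add: \<rho>_def)
    qed (use \<open>r > 0\<close> in auto)
    finally show "norm (\<Sum>x\<in>L \<times> {1..int V}. e_char p (d * (\<lambda>((u, k), v). \<psi> u k v) x)) ^ (2 * r) \<le> \<dots>" .
  qed
  also have "\<dots> = N ^ (2 * r - 1) * (\<Sum>x\<in>L.
      (\<Sum>d\<in>{0..<int p}. norm (\<Sum>v\<in>{1..int V}. e_char p (d * \<psi> (fst x) (snd x) v)) ^ (2 * r)) / \<rho> x)"
    by (subst sum_distrib_left [symmetric], subst sum.swap) (simp add: sum_divide_distrib)
  also have "\<dots> = N ^ (2 * r - 1) * (\<Sum>x\<in>L. real p * E (m x) / \<rho> x)"
  proof -
    have "(\<Sum>d\<in>{0..<int p}. norm (\<Sum>v\<in>{1..int V}. e_char p (d * \<psi> (fst x) (snd x) v)) ^ (2 * r))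
        = real p * E (m x)" if "x \<in> L" for x
    proof -
      obtain u k where x: "x = (u, k)" by fastforce
      have u: "\<not> int p dvd int u" using that unit by (auto simp: L_def x)
      \<comment> \<open>For a fixed pair \<open>(u, k)\<close> the common unit
        \<open>recip p u\<close> drops out of the energy, which therefore depends only on the
        quotient \<open>m x\<close>.\<close>
      have "energy_tuples p (2 * r) {1..int V} (\<psi> u k) =
          energy_tuples p (2 * r) {1..int V} (\<lambda>v. recip p (int u) * recip p (m x + v))"
        unfolding \<psi>_def m_def x case_prod_conv
        by (intro energy_tuples_cong recip_shift_cong p u)
      also have "\<dots> = energy_tuples p (2 * r) {1..int V} (\<lambda>v. recip p (m x + v))"
        by (intro energy_tuples_mult_unit recip_not_dvd p u)
      finally show ?thesis
        using even_moment_unweighted [OF p0, of "{1..int V}" "\<psi> u k" r] by (simp add: x E_def)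
    qed
    then show ?thesis by (metis (no_types, lifting) sum.cong)
  qed
  also have "(\<Sum>x\<in>L. real p * E (m x) / \<rho> x) = real p * (\<Sum>\<mu>\<in>m ` L. E \<mu>)"
    unfolding \<rho>_def sum_div_card_fibre [OF finL, of "\<lambda>\<mu>. real p * E \<mu>"]
    by (simp add: sum_distrib_left)
  finally have "real (card (energy_tuples p (2 * r) {c + 1..c + int K} (recip p))) * real (U * V) ^ (2 * r)
      \<le> N ^ (2 * r - 1) * (\<Sum>\<mu>\<in>m ` L. E \<mu>)"
    using p0 by (simp add: mult.left_commute [of _ "real p"])
  also have "\<dots> \<le> N ^ (2 * r - 1) * real (p * (V ^ r * r ^ (2 * r)) + 4 * r * V ^ (2 * r))"
  proof (rule mult_left_mono)
    \<comment> \<open>Each quotient now occurs once, so positivity permits completing the sum to all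
      residues.\<close>
    have "(\<Sum>\<mu>\<in>m ` L. E \<mu>) \<le> (\<Sum>\<mu>\<in>{0..<int p}. E \<mu>)"
      using p0 by (intro sum_mono2) (auto simp: m_def E_def)
    also have "\<dots> \<le> real (p * (V ^ r * r ^ (2 * r)) + 4 * r * V ^ (2 * r))"
      unfolding E_def of_nat_sum [symmetric] of_nat_le_iff
      by (rule sum_card_energy_shifted_recip_le) (use assms in auto)
    finally show "(\<Sum>\<mu>\<in>m ` L. E \<mu>) \<le> \<dots>" .
  qed (simp add: N_def \<rho>_def sum_nonneg)
  finally have main: "real (card (energy_tuples p (2 * r) {c + 1..c + int K} (recip p))) * real (U * V) ^ (2 * r)
      \<le> N ^ (2 * r - 1) * real (p * (V ^ r * r ^ (2 * r)) + 4 * r * V ^ (2 * r))" .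

  have "N = (\<Sum>x\<in>{1..U} \<times> I. real (card {y \<in> {1..U} \<times> I. int p dvd snd x * int (fst y) - snd y * int (fst x)}))"
  proof -
    have "m y = m x \<longleftrightarrow> int p dvd snd x * int (fst y) - snd y * int (fst x)"
      if "x \<in> {1..U} \<times> I" "y \<in> {1..U} \<times> I" for x y
    proof -
      have "\<not> int p dvd int (fst x)" "\<not> int p dvd int (fst y)"
        using that by (intro unit; force)+
      from quotient_cong_iff [OF p this, of "snd x" "snd y"] show ?thesis
        by (auto simp: m_def case_prod_unfold)
    qed
    then show ?thesis
      unfolding N_def \<rho>_def L_def by (intro sum.cong arg_cong [of _ _ "\<lambda>A. real (card A)"] Collect_cong conj_cong refl)
  qed
  also have "\<dots> \<le> real n * real U * (1 + harm U ^ 2)"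
    unfolding I_def
  proof (rule sum_card_proportional_le)
    \<comment> \<open>The enlarged interval can be twice as long as the original one, whence
      \<open>4 * U * K\<close> rather than \<open>2 * U * K\<close> in the hypothesis.\<close>
    have "2 * U * n \<le> 2 * U * (2 * K)" using n(2) by (intro mult_le_mono2)
    also have "\<dots> = 4 * U * K" by simp
    also note UK
    finally show "2 * U * n \<le> p" .
  qed (use \<open>U \<le> K\<close> n in simp)
  also have "\<dots> \<le> 2 * real K * real U * (1 + harm U ^ 2)"
    using n(2) by (intro mult_right_mono) auto
  finally have "N ^ (2 * r - 1) \<le> (2 * real K * real U * (1 + harm U ^ 2)) ^ (2 * r - 1)"
    by (intro power_mono) (auto simp: N_def \<rho>_def intro: sum_nonneg)
  then have "N ^ (2 * r - 1) * real (p * (V ^ r * r ^ (2 * r)) + 4 * r * V ^ (2 * r)) \<le>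
      (2 * real K * real U * (1 + harm U ^ 2)) ^ (2 * r - 1) * real (p * (V ^ r * r ^ (2 * r)) + 4 * r * V ^ (2 * r))"
    by (intro mult_right_mono) auto
  with main show ?thesis by simp
qed

subsection \<open>The energy of reciprocals of an interval\<close>

lemma unit_interval_length_less:
  fixes c :: int
  assumes "p > 0" and units: "\<And>j. j \<in> {c + 1..c + int K} \<Longrightarrow> \<not> int p dvd j"
  shows "K < p"
proof (rule ccontr)
  assume "\<not> K < p"
  \<comment> \<open>The smallest multiple of \<open>p\<close> exceeding \<open>c\<close>.\<close>
  define j where "j = c + int p - c mod int p"
  have "0 \<le> c mod int p" "c mod int p < int p" using assms(1) by simp_all
  with \<open>\<not> K < p\<close> have "j \<in> {c + 1..c + int K}" by (simp add: j_def)
  moreover have "int p dvd j"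
  proof -
    have "j = int p * (c div int p) + int p"
      by (simp add: j_def minus_mod_eq_mult_div [symmetric])
    then show ?thesis by simp
  qed
  ultimately show False using units by blast
qed

lemma interval_cong_eq:
  fixes c :: int
  assumes "K \<le> p" "i \<in> {c + 1..c + int K}" "j \<in> {c + 1..c + int K}" "[i = j] (mod int p)"
  shows "i = j"
proof -
  have "\<bar>i - j\<bar> < int p" using assms(1-3) by auto
  moreover have "int p dvd i - j" using assms(4) by (simp add: cong_iff_dvd_diff)
  ultimately have "i - j = 0"
    by (metis abs_of_nat dvd_imp_le_int linorder_not_less)
  then show ?thesis by simp
qed

text \<open>Only diagonal solutions occur: \<open>recip\<close> is injective on units modulo
  \<open>p\<close>, and an interval of units is shorter than \<open>p\<close>.\<close>

lemma card_second_energy_recip_le: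
  assumes p: "prime p" "p > 2" and units: "\<And>j. j \<in> {c + 1..c + int K} \<Longrightarrow> \<not> int p dvd j"
  shows "card (energy_tuples p 2 {c + 1..c + int K} (recip p)) \<le> K"
proof -
  let ?E = "energy_tuples p 2 {c + 1..c + int K} (recip p)"
  have K: "K \<le> p" using unit_interval_length_less [of p c K] units p by force
  have eq: "w 1 = w 0" "w 0 \<in> {c + 1..c + int K}" if "w \<in> ?E" for w
  proof -
    have w: "w i \<in> {c + 1..c + int K}" if "i < 2" for i
      using \<open>w \<in> ?E\<close> that unfolding energy_tuples_def by blast
    have "int p dvd recip p (w 0) - recip p (w 1)"
      using \<open>w \<in> ?E\<close> by (simp add: energy_tuples_def alternating_sum_def numeral_2_eq_2)
    then have "[recip p (w 1) = recip p (w 0)] (mod int p)"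
      by (simp add: cong_iff_dvd_diff dvd_diff_commute)
    then have "[w 1 = w 0] (mod int p)"
      by (rule recip_inj_mod [OF p units units, rotated 2]) (use w in simp_all)
    then show "w 1 = w 0"
      by (rule interval_cong_eq [OF K, of _ c, rotated 2]) (rule w, simp)+
    show "w 0 \<in> {c + 1..c + int K}" by (rule w) simp
  qed
  have "inj_on (\<lambda>w. w 0) ?E"
  proof (rule inj_onI)
    fix w w' assume w: "w \<in> ?E" "w' \<in> ?E" "w 0 = w' 0"
    then have "w i = w' i" if "i < 2" for i
      using eq(1) [OF w(1)] eq(1) [OF w(2)] that by (cases "i = 0") (auto simp: less_2_cases_iff)
    then show "w = w'"
      using w unfolding energy_tuples_def by (intro PiE_ext [of w "{..<2}" _ w']) auto
  qed
  moreover have "(\<lambda>w. w 0) ` ?E \<subseteq> {c + 1..c + int K}" using eq(2) by blast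
  ultimately have "card ?E \<le> card {c + 1..c + int K}"
    by (rule card_inj_on_le) simp
  then show ?thesis by simp
qed

text \<open>Shifting has no room when \<open>K\<close> exceeds \<open>p / 4\<close>, but trivial
  bounds suffice: all but two factors of the moment are estimated by \<open>K\<close>, and the
  remaining second moment is at most \<open>p * K\<close>, hence at most
  \<open>4 * K * K\<close>.\<close>

lemma energy_recip_long_interval_le:
  assumes p: "prime p" "p > 2" and units: "\<And>j. j \<in> {c + 1..c + int K} \<Longrightarrow> \<not> int p dvd j"
    and "r > 0" and long: "p < 4 * K"
  shows "real p * real (card (energy_tuples p (2 * r) {c + 1..c + int K} (recip p)))
       \<le> 4 * real K ^ (2 * r)"
proof -
  let ?G = "\<lambda>d. norm (\<Sum>k\<in>{c + 1..c + int K}. e_char p (d * recip p k))"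
  have p0: "p > 0" using p by simp
  have r: "2 * r = (2 * r - 2) + 2" using \<open>r > 0\<close> by simp
  have G: "?G d \<le> real K" for d
  proof -
    have "?G d \<le> real (card {c + 1..c + int K}) * 1" by (rule sum_norm_bound) simp
    then show ?thesis by simp
  qed
  have "real p * real (card (energy_tuples p (2 * r) {c + 1..c + int K} (recip p)))
      = (\<Sum>d\<in>{0..<int p}. ?G d ^ (2 * r))"
    by (intro even_moment_unweighted [symmetric] p0) simp
  also have "\<dots> \<le> (\<Sum>d\<in>{0..<int p}. real K ^ (2 * r - 2) * ?G d ^ 2)"
  proof (rule sum_mono)
    fix d
    have "?G d ^ (2 * r) = ?G d ^ (2 * r - 2) * ?G d ^ 2" using r by (metis power_add)
    also have "\<dots> \<le> real K ^ (2 * r - 2) * ?G d ^ 2"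
      by (intro mult_right_mono power_mono G) auto
    finally show "?G d ^ (2 * r) \<le> real K ^ (2 * r - 2) * ?G d ^ 2" .
  qed
  also have "\<dots> = real K ^ (2 * r - 2) * (real p * real (card (energy_tuples p 2 {c + 1..c + int K} (recip p))))"
    using even_moment_unweighted [OF p0, of "{c + 1..c + int K}" "recip p" 1]
    by (simp add: sum_distrib_left [symmetric])
  also have "\<dots> \<le> real K ^ (2 * r - 2) * (real (4 * K) * real K)"
    using long card_second_energy_recip_le [OF p units]
    by (intro mult_left_mono mult_mono of_nat_mono) auto
  also have "\<dots> = 4 * real K ^ (2 * r)"
    using r by (metis (no_types, lifting) mult.assoc mult.left_commute of_nat_mult of_nat_numeral power2_eq_square power_add)
  finally show ?thesis .
qed

text \<open>Choosing the parameters in the shifting bound and cancelling leaves a single factor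
  \<open>U\<close> next to the energy. The size of \<open>U\<close> produces the two terms in the
  last factor, one for each argument of the minimum.\<close>

lemma energy_recip_short_interval_le:
  assumes p: "prime p" "p > 2" and "r > 0" and short: "4 * K \<le> p"
    and K: "real p powr (1 / real r) \<le> real K"
  shows "real p * real (card (energy_tuples p (2 * r) {c + 1..c + int K} (recip p)))
       \<le> 8 * 4 ^ (2 * r - 1) * (real r ^ (2 * r) + 4 * real r) * (1 + ln (real p)) ^ (2 * (2 * r - 1)) *
           real K ^ (2 * r) * (1 + real p powr (1 + 1 / real r) / (real K)\<^sup>2)"
proof -
  define J where "J = real (card (energy_tuples p (2 * r) {c + 1..c + int K} (recip p)))"
  define t where "t = real p powr (1 / real r)"
  \<comment> \<open>Rounding up ensures \<open>p \<le> V ^ r\<close>, so the contribution of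
    degenerate tuples is at most a constant times \<open>V ^ (2 * r)\<close>; rounding at most
    doubles \<open>t\<close> because \<open>t \<ge> 1\<close>.\<close>
  define V where "V = nat \<lceil>t\<rceil>"
  \<comment> \<open>The largest value compatible with both \<open>U * V \<le> K\<close> and
    \<open>4 * U * K \<le> p\<close>.\<close>
  define U where "U = min (K div V) (p div (4 * K))"
  define L where "L = 1 + ln (real p)"
  define C where "C = real r ^ (2 * r) + 4 * real r"
  define Q where "Q = real p powr (1 + 1 / real r) / (real K)\<^sup>2"
  have p0: "real p > 0" "real p \<ge> 1" using p by simp_all
  have t: "t \<ge> 1" using p0 by (simp add: t_def ge_one_powr_ge_zero)
  have V: "t \<le> real V" "real V \<le> 2 * t" "V > 0" "V \<le> K"
    using t K unfolding V_def t_def [symmetric] by linarith+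
  have K0: "K > 0" using V by simp
  have "V < p" using V(4) K0 short by linarith
  have "real p = t ^ r"
    using \<open>r > 0\<close> p0 by (simp add: t_def powr_power)
  also have "\<dots> \<le> real V ^ r"
    using t V by (intro power_mono) auto
  finally have pV: "real p \<le> real V ^ r" .
  have U0: "U > 0"
    using V(3,4) K0 short by (simp add: U_def div_greater_zero_iff)
  have UV: "U * V \<le> K" and UK: "4 * U * K \<le> p"
  proof -
    have "U * V \<le> K div V * V" by (intro mult_le_mono1) (simp add: U_def)
    then show "U * V \<le> K" by (rule order_trans) (rule div_times_less_eq_dividend)
    have "U * (4 * K) \<le> p div (4 * K) * (4 * K)" by (intro mult_le_mono1) (simp add: U_def)
    also have "\<dots> \<le> p" by (rule div_times_less_eq_dividend)
    finally show "4 * U * K \<le> p" by (simp add: mult_ac)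
  qed
  have "U \<le> U * K" using K0 by simp
  with UK U0 have "U \<le> p" by linarith
  have L1: "L \<ge> 1" using p0 by (simp add: L_def)
  have "harm U \<le> L"
  proof -
    have "harm U \<le> 1 + ln (real U)" by (rule harm_le_1_plus_ln [OF U0])
    also have "\<dots> \<le> L" using U0 \<open>U \<le> p\<close> by (simp add: L_def)
    finally show ?thesis .
  qed
  then have "(harm U :: real)\<^sup>2 \<le> L\<^sup>2" by (intro power_mono harm_nonneg)
  moreover have "1 \<le> L\<^sup>2" using L1 by (rule one_le_power)
  ultimately have harm: "1 + (harm U :: real)\<^sup>2 \<le> 2 * L\<^sup>2" by linarith
  have C0: "C > 0" using \<open>r > 0\<close> by (simp add: C_def add_nonneg_pos)

  have "J * real (U * V) ^ (2 * r) \<le> (2 * real K * real U * (1 + harm U ^ 2)) ^ (2 * r - 1) *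
      (real p * (real V ^ r * real r ^ (2 * r)) + 4 * real r * real V ^ (2 * r))"
    unfolding J_def by (rule energy_recip_interval_le) (use assms U0 V \<open>V < p\<close> UV UK in auto)
  also have "\<dots> \<le> (2 * real K * real U * (2 * L\<^sup>2)) ^ (2 * r - 1) * (C * real V ^ (2 * r))"
  proof (rule mult_mono)
    show "(2 * real K * real U * (1 + harm U ^ 2)) ^ (2 * r - 1) \<le> (2 * real K * real U * (2 * L\<^sup>2)) ^ (2 * r - 1)"
      using harm by (intro power_mono mult_left_mono) auto
    have "real p * (real V ^ r * real r ^ (2 * r)) \<le> real V ^ r * (real V ^ r * real r ^ (2 * r))"
      by (intro mult_right_mono pV) auto
    also have "\<dots> = real r ^ (2 * r) * real V ^ (2 * r)"
      by (simp add: mult_2 power_add)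
    finally show "real p * (real V ^ r * real r ^ (2 * r)) + 4 * real r * real V ^ (2 * r) \<le> C * real V ^ (2 * r)"
      by (simp add: C_def algebra_simps)
  qed auto
  finally have "J * real U ^ (2 * r) * real V ^ (2 * r) \<le>
      ((4 * L\<^sup>2 * real K) ^ (2 * r - 1) * real U ^ (2 * r - 1) * C) * real V ^ (2 * r)"
    by (simp add: power_mult_distrib mult_ac)
  then have "J * real U ^ (2 * r) \<le> (4 * L\<^sup>2 * real K) ^ (2 * r - 1) * real U ^ (2 * r - 1) * C"
    using V(3) by simp
  moreover have "real U ^ (2 * r) = real U * real U ^ (2 * r - 1)"
    using \<open>r > 0\<close> by (simp add: power_Suc [symmetric] del: power_Suc)
  ultimately have "(J * real U) * real U ^ (2 * r - 1) \<le> ((4 * L\<^sup>2 * real K) ^ (2 * r - 1) * C) * real U ^ (2 * r - 1)"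
    by (simp add: mult_ac)
  then have JU: "J * real U \<le> (4 * L\<^sup>2 * real K) ^ (2 * r - 1) * C"
    using U0 by simp

  \<comment> \<open>If the first argument of the minimum is active, \<open>p\<close> is at most
    \<open>4 * K * Q * U\<close>; otherwise it is at most \<open>8 * K * U\<close>. Rounding down in
    the quotients costs the factor 2 recorded in \<open>twice\<close>.\<close>
  have "real p \<le> 8 * real K * (1 + Q) * real U"
  proof -
    have twice: "real n \<le> 2 * real m * real (n div m)" if "m > 0" "m \<le> n" for m n :: nat
    proof -
      have "n div m > 0" using that by (simp add: div_greater_zero_iff)
      then have "m * 1 \<le> m * (n div m)" by (intro mult_le_mono2) simp
      moreover have "n = m * (n div m) + n mod m" "n mod m < m" using that by simp_all
      ultimately have "n \<le> 2 * m * (n div m)" by linarith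
      then show ?thesis by (metis of_nat_le_iff of_nat_mult of_nat_numeral)
    qed
    have Q0: "Q \<ge> 0" by (simp add: Q_def)
    have KQ: "real K * Q = real p * t / real K"
      using K0 p0 by (simp add: Q_def t_def powr_add power2_eq_square)
    show ?thesis
    proof (cases "K div V \<le> p div (4 * K)")
      case True
      then have U: "U = K div V" by (simp add: U_def)
      have "real p * real K \<le> real p * (2 * real V * real U)"
        using twice [OF V(3,4)] by (intro mult_left_mono) (simp_all add: U)
      also have "\<dots> \<le> real p * (2 * (2 * t) * real U)"
        using V(2) by (intro mult_left_mono mult_right_mono) auto
      finally have "real p \<le> 4 * (real p * t / real K) * real U"
        using K0 by (simp add: field_simps)
      also have "\<dots> \<le> 8 * real K * (1 + Q) * real U"
        unfolding KQ [symmetric] using Q0 by (intro mult_right_mono) (auto simp: algebra_simps)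
      finally show ?thesis .
    next
      case False
      then have "U = p div (4 * K)" by (simp add: U_def)
      then have "real p \<le> 8 * real K * real U"
        using twice [of "4 * K" p] K0 short by simp
      also have "\<dots> \<le> 8 * real K * (1 + Q) * real U"
        using Q0 by (intro mult_right_mono) (auto simp: algebra_simps)
      finally show ?thesis .
    qed
  qed
  then have "real p * J \<le> 8 * real K * (1 + Q) * real U * J"
    by (intro mult_right_mono) (simp_all add: J_def)
  also have "\<dots> = 8 * real K * (1 + Q) * (J * real U)"
    by (simp add: mult_ac)
  also have "\<dots> \<le> 8 * real K * (1 + Q) * ((4 * L\<^sup>2 * real K) ^ (2 * r - 1) * C)"
    by (intro mult_left_mono JU) (auto simp: Q_def)
  also have "\<dots> = 8 * 4 ^ (2 * r - 1) * C * L ^ (2 * (2 * r - 1)) * (real K * real K ^ (2 * r - 1)) * (1 + Q)"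
    by (simp add: power_mult_distrib power_mult [symmetric] mult_ac)
  also have "real K * real K ^ (2 * r - 1) = real K ^ (2 * r)"
    using \<open>r > 0\<close> by (simp add: power_Suc [symmetric] del: power_Suc)
  finally show ?thesis by (simp add: J_def C_def L_def Q_def)
qed

lemma energy_recip_le:
  assumes p: "prime p" "p > 2" and "r > 0"
    and units: "\<And>j. j \<in> {c + 1..c + int K} \<Longrightarrow> \<not> int p dvd j"
    and K: "real p powr (1 / real r) \<le> real K"
  shows "real p * real (card (energy_tuples p (2 * r) {c + 1..c + int K} (recip p)))
       \<le> 8 * 4 ^ (2 * r - 1) * (real r ^ (2 * r) + 4 * real r) * (1 + ln (real p)) ^ (2 * (2 * r - 1)) *
           real K ^ (2 * r) * (1 + real p powr (1 + 1 / real r) / (real K)\<^sup>2)"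
proof (cases "4 * K \<le> p")
  case True
  with assms show ?thesis by (intro energy_recip_short_interval_le) auto
next
  case False
  \<comment> \<open>For long intervals the bound \<open>4 * K ^ (2 * r)\<close> is already stronger,
    since the remaining factors of the target, collected in \<open>D\<close>, are each at least
    1.\<close>
  define D where "D = 4 ^ (2 * r - 1) * (real r ^ (2 * r) + 4 * real r) * (1 + ln (real p)) ^ (2 * (2 * r - 1)) *
      (1 + real p powr (1 + 1 / real r) / (real K)\<^sup>2)"
  have "1 * 1 * 1 * 1 \<le> D"
  proof -
    have "1 \<le> 4 * real r" using \<open>r > 0\<close> by simp
    also have "\<dots> \<le> real r ^ (2 * r) + 4 * real r" by simp
    finally show ?thesis
      unfolding D_def using p by (intro mult_mono one_le_power) auto
  qed
  then have "4 * real K ^ (2 * r) * 1 \<le> 8 * real K ^ (2 * r) * D"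
    by (intro mult_mono) auto
  moreover have "real p * real (card (energy_tuples p (2 * r) {c + 1..c + int K} (recip p))) \<le> 4 * real K ^ (2 * r)"
    using False by (intro energy_recip_long_interval_le p units \<open>r > 0\<close>) auto
  ultimately show ?thesis by (simp add: D_def mult_ac)
qed

subsection \<open>The bilinear form\<close>

text \<open>Apply \<open>ln y \<le> y - 1\<close> to \<open>y = x powr \<theta>\<close>; the
  condition \<open>\<theta> \<le> 1\<close> absorbs the constant term.\<close>

lemma one_plus_ln_le_powr:
  fixes x \<theta> :: real
  assumes "0 < \<theta>" "\<theta> \<le> 1" "x \<ge> 1"
  shows "1 + ln x \<le> x powr \<theta> / \<theta>"
proof -
  have "\<theta> * ln x = ln (x powr \<theta>)" using assms by (simp add: ln_powr)
  also have "\<dots> \<le> x powr \<theta> - 1" using assms by (intro ln_le_minus_one) auto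
  finally have "\<theta> * (1 + ln x) \<le> x powr \<theta>" using assms by (simp add: algebra_simps)
  then show ?thesis using assms by (simp add: field_simps)
qed

lemma norm_le_sup_weight: "finite A \<Longrightarrow> x \<in> A \<Longrightarrow> norm (w x) \<le> sup_weight A w"
  by (simp add: sup_weight_def)

lemma sup_weight_nonneg: "finite A \<Longrightarrow> A \<noteq> {} \<Longrightarrow> 0 \<le> sup_weight A w"
  by (meson ex_in_conv norm_ge_zero norm_le_sup_weight order_trans)

text \<open>Hoelder over \<open>m\<close> isolates the inner sums, whose \<open>2 * r\<close>-th
  powers are nonnegative, so \<open>\<M>\<close> may be enlarged to all residues. The complete
  moment then disposes of \<open>\<gamma>\<close>, and the unit \<open>a\<close> disappears by
  scaling.\<close>

lemma bilinear_reciprocal_power_le: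
  fixes \<alpha> \<gamma> :: "int \<Rightarrow> complex"
  assumes p: "prime p" "p > 2" and "r > 0"
    and M: "\<M> \<subseteq> {0..<int p}" "\<M> \<noteq> {}"
    and units: "\<And>j. j \<in> {c + 1..c + int K} \<Longrightarrow> \<not> int p dvd j"
    and a: "\<not> int p dvd a"
    and \<alpha>: "\<And>m. m \<in> \<M> \<Longrightarrow> norm (\<alpha> m) \<le> A"
    and \<gamma>: "\<And>k. k \<in> {c + 1..c + int K} \<Longrightarrow> norm (\<gamma> k) \<le> B"
  shows "norm (\<Sum>m\<in>\<M>. \<Sum>k\<in>{c + 1..c + int K}. \<alpha> m * \<gamma> k * e_char p (m * (a * recip p k))) ^ (2 * r)
     \<le> A ^ (2 * r) * B ^ (2 * r) * real (card \<M>) ^ (2 * r - 1) *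
        (real p * real (card (energy_tuples p (2 * r) {c + 1..c + int K} (recip p))))"
proof -
  let ?I = "{c + 1..c + int K}"
  let ?F = "\<lambda>m. norm (\<Sum>k\<in>?I. \<gamma> k * e_char p (m * (a * recip p k)))"
  have p0: "p > 0" using p by simp
  have fin: "finite \<M>" using M(1) by (rule finite_subset) simp
  have A: "A \<ge> 0" using M(2) \<alpha> by (meson ex_in_conv norm_ge_zero order_trans)
  have "(\<Sum>m\<in>\<M>. ?F m ^ (2 * r)) \<le> (\<Sum>m\<in>{0..<int p}. ?F m ^ (2 * r))"
    using M(1) by (intro sum_mono2) auto
  also have "\<dots> \<le> B ^ (2 * r) * (real p * card (energy_tuples p (2 * r) ?I (\<lambda>k. a * recip p k)))"
    by (intro even_moment_weighted_le p0 \<gamma>) auto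
  also have "energy_tuples p (2 * r) ?I (\<lambda>k. a * recip p k) = energy_tuples p (2 * r) ?I (recip p)"
    by (rule energy_tuples_mult_unit [OF p(1) a])
  finally have moment: "(\<Sum>m\<in>\<M>. ?F m ^ (2 * r)) \<le>
      B ^ (2 * r) * (real p * card (energy_tuples p (2 * r) ?I (recip p)))" .
  have "norm (\<Sum>m\<in>\<M>. \<Sum>k\<in>?I. \<alpha> m * \<gamma> k * e_char p (m * (a * recip p k))) =
      norm (\<Sum>m\<in>\<M>. \<alpha> m * (\<Sum>k\<in>?I. \<gamma> k * e_char p (m * (a * recip p k))))"
    by (simp add: sum_distrib_left mult.assoc)
  also have "\<dots> \<le> (\<Sum>m\<in>\<M>. A * ?F m)"
    by (rule sum_norm_le) (simp add: norm_mult mult_right_mono \<alpha>)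
  finally have "norm (\<Sum>m\<in>\<M>. \<Sum>k\<in>?I. \<alpha> m * \<gamma> k * e_char p (m * (a * recip p k))) ^ (2 * r)
      \<le> (A * (\<Sum>m\<in>\<M>. ?F m)) ^ (2 * r)"
    by (intro power_mono) (simp_all add: sum_distrib_left)
  also have "\<dots> = A ^ (2 * r) * (\<Sum>m\<in>\<M>. ?F m) ^ (2 * r)"
    by (rule power_mult_distrib)
  also have "\<dots> \<le> A ^ (2 * r) * (real (card \<M>) ^ (2 * r - 1) * (\<Sum>m\<in>\<M>. ?F m ^ (2 * r)))"
    using weighted_sum_power_le [OF fin, of ?F "\<lambda>_. 1" "2 * r"] \<open>r > 0\<close> A
    by (intro mult_left_mono) auto
  also have "\<dots> \<le> A ^ (2 * r) * (real (card \<M>) ^ (2 * r - 1) *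
      (B ^ (2 * r) * (real p * card (energy_tuples p (2 * r) ?I (recip p)))))"
    using A by (intro mult_left_mono moment) auto
  finally show ?thesis by (simp only: mult_ac)
qed

theorem theorem2p5:
  fixes r :: nat
  assumes "r \<ge> 1"
  shows "\<forall>\<epsilon>::real. \<epsilon> > 0 \<longrightarrow> (\<exists>C::real. \<exists>p0::nat. C > 0 \<and>
    (\<forall>p::nat. prime p \<and> p \<ge> p0 \<longrightarrow>
      (\<forall>(\<M>::int set) (M::nat) (\<K>::int set) (k0::int) (K::nat) (a::int)
         (\<alpha>::int \<Rightarrow> complex) (\<gamma>::int \<Rightarrow> complex).
        \<M> \<subseteq> prime_field p \<and> card \<M> = M \<and> M \<ge> 1 \<and>
        \<K> = residue_interval p k0 K \<and> \<K> \<subseteq> prime_field_units p \<and>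
        real K \<ge> real p powr (1 / real r) \<and>
        a \<in> prime_field_units p \<longrightarrow>
        norm (\<Sum>m\<in>\<M>. \<Sum>k\<in>\<K>. \<alpha> m * \<gamma> k * e_char p (a * m * modular_inverse (int p) k))
          \<le> C * sup_weight \<M> \<alpha> * sup_weight \<K> \<gamma> * real M * real K * real p powr \<epsilon> *
             (1 / real M + real p powr (1 + 1 / real r) / (real M * (real K)\<^sup>2))
               powr (7 / (24 * real r)))))"
proof (intro allI impI, goal_cases)
  case (1 \<epsilon>)
  \<comment> \<open>The \<open>2 * r\<close>-th root of the energy bound carries fewer than two
    logarithmic factors. Each is replaced by \<open>p powr \<theta> / \<theta>\<close>, which also
    explains the division by the square of \<open>\<theta>\<close> in \<open>C\<close>.\<close>
  define \<theta> where "\<theta> = min 1 (\<epsilon> / 2)"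
  have \<theta>: "0 < \<theta>" "\<theta> \<le> 1" "2 * \<theta> \<le> \<epsilon>" using 1 by (auto simp: \<theta>_def)
  define D where "D = 8 * 4 ^ (2 * r - 1) * (real r ^ (2 * r) + 4 * real r)"
  have D: "D \<ge> 1"
  proof -
    have "1 * 1 * 1 \<le> D"
      unfolding D_def using assms by (intro mult_mono one_le_power) (auto intro: add_increasing)
    then show ?thesis by simp
  qed
  define C where "C = D / \<theta>\<^sup>2"
  have "\<theta>\<^sup>2 \<le> 1" using \<theta> by (simp add: power_le_one)
  then have C: "C \<ge> 1" using D \<theta> by (simp add: C_def le_divide_eq)
  show ?case
  \<comment> \<open>The threshold 3 serves only to exclude \<open>p = 2\<close>, where
    \<open>recip\<close> is constantly 1.\<close>
  proof (rule exI [of _ C], rule exI [of _ 3], intro conjI allI impI, goal_cases)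
    case 1
    then show ?case using C by simp
  next
    case (2 p \<M> M \<K> k0 K a \<alpha> \<gamma>)
    then have p: "prime p" "p > 2" and M: "\<M> \<subseteq> {0..<int p}" "card \<M> = M" "M \<ge> 1"
      and \<K>: "\<K> = (\<lambda>j. j mod int p) ` {k0 + 1..k0 + int K}" "\<K> \<subseteq> {0..<int p} - {0}"
      and K: "real p powr (1 / real r) \<le> real K" and a: "a \<in> {0..<int p} - {0}"
      by (auto simp: prime_field_def prime_field_units_def residue_interval_def)
    let ?I = "{k0 + 1..k0 + int K}"
    let ?S = "\<Sum>m\<in>\<M>. \<Sum>k\<in>\<K>. \<alpha> m * \<gamma> k * e_char p (a * m * modular_inverse (int p) k)"
    define A where "A = sup_weight \<M> \<alpha>"
    define B where "B = sup_weight \<K> \<gamma>"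
    define Q where "Q = real p powr (1 + 1 / real r) / (real K)\<^sup>2"
    define \<delta> where "\<delta> = (1 + Q) / real M"
    define X where "X = A * B * real M * real K"
    have p0: "p > 0" "real p \<ge> 1" using p by simp_all
    have "real p powr (1 / real r) > 0" using p0 by simp
    with K have K0: "K > 0" by (metis of_nat_0_less_iff order_less_le_trans)
    have units: "\<not> int p dvd j" if "j \<in> ?I" for j
    proof -
      have "j mod int p \<in> \<K>" using \<K>(1) that by blast
      from subsetD [OF \<K>(2) this] show ?thesis by (simp add: dvd_eq_mod_eq_0)
    qed
    have a_unit: "\<not> int p dvd a" using a by (auto dest: zdvd_imp_le)
    have fin: "finite \<M>" "\<M> \<noteq> {}" "finite \<K>" "\<K> \<noteq> {}"
      using M(2,3) \<K>(1) K0 by (auto intro: card_ge_0_finite)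
    have inj: "inj_on (\<lambda>j. j mod int p) ?I"
    proof (rule inj_onI)
      fix i j assume "i \<in> ?I" "j \<in> ?I" "i mod int p = j mod int p"
      then show "i = j"
        using unit_interval_length_less [OF p0(1), of k0 K] units
        by (intro interval_cong_eq [of K p i k0 j]) (auto simp: cong_def)
    qed
    have A0: "A \<ge> 0" and B0: "B \<ge> 0"
      using fin by (simp_all add: A_def B_def sup_weight_nonneg)
    have \<alpha>: "norm (\<alpha> m) \<le> A" if "m \<in> \<M>" for m
      unfolding A_def by (intro norm_le_sup_weight fin that)
    have \<gamma>: "norm (\<gamma> k) \<le> B" if "k \<in> \<K>" for k
      unfolding B_def by (intro norm_le_sup_weight fin that)
    have X0: "X \<ge> 0" using A0 B0 by (simp add: X_def)
    have Q0: "Q \<ge> 0" by (simp add: Q_def)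
    have \<delta>0: "\<delta> > 0" using M Q0 by (simp add: \<delta>_def)
    \<comment> \<open>Passing from residues to the integers of the interval: reduction is injective
      there, and the character sees only congruence classes, so \<open>recip\<close> can replace the
      modular inverse.\<close>
    have "(\<Sum>k\<in>\<K>. \<alpha> m * \<gamma> k * e_char p (a * m * modular_inverse (int p) k)) =
        (\<Sum>j\<in>?I. \<alpha> m * \<gamma> (j mod int p) * e_char p (m * (a * recip p j)))" for m
      unfolding \<K>(1) sum.reindex [OF inj]
    proof (rule sum.cong [OF refl], unfold o_def)
      fix j
      have "[modular_inverse (int p) (j mod int p) = recip p (j mod int p)] (mod int p)"
        by (rule modular_inverse_cong_recip [OF p])
      also have "[recip p (j mod int p) = recip p j] (mod int p)"
        by (rule recip_cong) simp
      finally have "[a * m * modular_inverse (int p) (j mod int p) = a * m * recip p j] (mod int p)"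
        by (rule cong_scalar_left)
      from e_char_cong [OF p0(1) this]
      show "\<alpha> m * \<gamma> (j mod int p) * e_char p (a * m * modular_inverse (int p) (j mod int p)) =
          \<alpha> m * \<gamma> (j mod int p) * e_char p (m * (a * recip p j))"
        by (simp add: mult_ac)
    qed
    then have "norm ?S ^ (2 * r) = norm (\<Sum>m\<in>\<M>. \<Sum>j\<in>?I. \<alpha> m * \<gamma> (j mod int p) * e_char p (m * (a * recip p j))) ^ (2 * r)"
      by simp
    also have "\<dots> \<le> A ^ (2 * r) * B ^ (2 * r) * real (card \<M>) ^ (2 * r - 1) *
        (real p * real (card (energy_tuples p (2 * r) ?I (recip p))))"
      using assms \<gamma> \<K>(1) by (intro bilinear_reciprocal_power_le p M(1) fin units a_unit \<alpha>) auto
    also have "\<dots> \<le> A ^ (2 * r) * B ^ (2 * r) * real M ^ (2 * r - 1) *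
        (D * (1 + ln (real p)) ^ (2 * (2 * r - 1)) * real K ^ (2 * r) * (1 + Q))"
      unfolding D_def Q_def M(2) using assms A0 B0
      by (intro mult_left_mono energy_recip_le p units K) auto
    also have "\<dots> = X ^ (2 * r) * \<delta> * (D * (1 + ln (real p)) ^ (2 * (2 * r - 1)))"
    proof -
      have "real M ^ (2 * r) = real M ^ (2 * r - 1) * real M"
        using assms by (metis One_nat_def Suc_pred mult_pos_pos pos2 power_Suc2 zero_less_one less_le_trans)
      then have "real M ^ (2 * r - 1) * (1 + Q) = real M ^ (2 * r) * \<delta>"
        using M(3) by (simp add: \<delta>_def)
      then show ?thesis by (simp add: X_def power_mult_distrib mult_ac)
    qed
    also have "\<dots> \<le> X ^ (2 * r) * \<delta> * (C * real p powr \<epsilon>) ^ (2 * r)"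
    proof (rule mult_left_mono)
      have "(real p powr \<theta> / \<theta>)\<^sup>2 = real p powr (2 * \<theta>) / \<theta>\<^sup>2"
        by (simp add: power_divide power2_eq_square powr_add [symmetric])
      also have "\<dots> \<le> real p powr \<epsilon> / \<theta>\<^sup>2"
        using \<theta> p0 by (intro divide_right_mono powr_mono) auto
      finally have sq: "(real p powr \<theta> / \<theta>)\<^sup>2 \<le> real p powr \<epsilon> / \<theta>\<^sup>2" .
      have "1 \<le> 1 + ln (real p)" using p0 by simp
      then have "(1 + ln (real p)) ^ (2 * (2 * r - 1)) \<le> (1 + ln (real p)) ^ (2 * (2 * r))"
        by (intro power_increasing) auto
      also have "\<dots> \<le> (real p powr \<theta> / \<theta>) ^ (2 * (2 * r))"
        using one_plus_ln_le_powr [OF \<theta>(1,2) p0(2)] p0 by (intro power_mono) auto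
      also have "\<dots> = ((real p powr \<theta> / \<theta>)\<^sup>2) ^ (2 * r)"
        by (rule power_mult)
      also have "\<dots> \<le> (real p powr \<epsilon> / \<theta>\<^sup>2) ^ (2 * r)"
        by (intro power_mono sq) simp
      finally have "(1 + ln (real p)) ^ (2 * (2 * r - 1)) \<le> (real p powr \<epsilon> / \<theta>\<^sup>2) ^ (2 * r)" .
      \<comment> \<open>A deliberate loss: as a full \<open>2 * r\<close>-th power, \<open>D\<close>
        can enter the constant \<open>C\<close> before the root is taken.\<close>
      moreover have "D \<le> D ^ (2 * r)"
        using D assms by (intro self_le_power) auto
      ultimately have "D * (1 + ln (real p)) ^ (2 * (2 * r - 1)) \<le> D ^ (2 * r) * (real p powr \<epsilon> / \<theta>\<^sup>2) ^ (2 * r)"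
        using D p0 by (intro mult_mono) auto
      then show "D * (1 + ln (real p)) ^ (2 * (2 * r - 1)) \<le> (C * real p powr \<epsilon>) ^ (2 * r)"
        by (simp add: C_def power_mult_distrib power_divide)
    qed (use X0 \<delta>0 in simp)
    finally have power: "norm ?S ^ (2 * r) \<le> (X * (C * real p powr \<epsilon>)) ^ (2 * r) * \<delta>"
      by (simp add: power_mult_distrib mult_ac)
    have Cp: "1 \<le> C * real p powr \<epsilon>"
    proof -
      have "1 * 1 \<le> C * real p powr \<epsilon>"
        using C p0 1 by (intro mult_mono ge_one_powr_ge_zero) auto
      then show ?thesis by simp
    qed
    \<comment> \<open>For \<open>\<delta> \<le> 1\<close> the root gives the exponent
      \<open>1 / (2 * r)\<close>, which is stronger because 7/24 is below 1/2. For larger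
      \<open>\<delta>\<close> its power is at least 1 and the termwise bound \<open>X\<close>
      suffices.\<close>
    have "norm ?S \<le> X * (C * real p powr \<epsilon>) * \<delta> powr (7 / (24 * real r))"
    proof (cases "\<delta> \<le> 1")
      case True
      have "\<delta> = (\<delta> powr (1 / (2 * real r))) ^ (2 * r)"
        using \<delta>0 assms by (simp add: powr_power)
      with power have "norm ?S ^ (2 * r) \<le> (X * (C * real p powr \<epsilon>) * \<delta> powr (1 / (2 * real r))) ^ (2 * r)"
        by (simp add: power_mult_distrib)
      then have "norm ?S \<le> X * (C * real p powr \<epsilon>) * \<delta> powr (1 / (2 * real r))"
        using assms X0 Cp by (subst (asm) power_mono_iff) auto
      also have "\<dots> \<le> X * (C * real p powr \<epsilon>) * \<delta> powr (7 / (24 * real r))"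
      proof (rule mult_left_mono)
        show "\<delta> powr (1 / (2 * real r)) \<le> \<delta> powr (7 / (24 * real r))"
          using True \<delta>0 assms by (intro powr_mono') (auto simp: field_simps)
      qed (use X0 Cp in \<open>simp add: mult_nonneg_nonneg\<close>)
      finally show ?thesis .
    next
      case False
      have "norm (\<alpha> m * \<gamma> k * e_char p (a * m * modular_inverse (int p) k)) \<le> A * B"
        if "m \<in> \<M>" "k \<in> \<K>" for m k
        using \<alpha> [OF that(1)] \<gamma> [OF that(2)] A0 by (simp add: norm_mult mult_mono)
      then have "norm ?S \<le> real (card \<M>) * (real (card \<K>) * (A * B))"
        by (intro sum_norm_bound) auto
      also have "card \<K> = K" using inj by (simp add: \<K>(1) card_image)
      finally have "norm ?S \<le> X * 1 * 1" using M(2) by (simp add: X_def mult_ac)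
      also have "\<dots> \<le> X * (C * real p powr \<epsilon>) * \<delta> powr (7 / (24 * real r))"
        using False X0 Cp assms by (intro mult_mono ge_one_powr_ge_zero) auto
      finally show ?thesis .
    qed
    moreover have "\<delta> = 1 / real M + real p powr (1 + 1 / real r) / (real M * (real K)\<^sup>2)"
      by (simp add: \<delta>_def Q_def add_divide_distrib mult.commute)
    ultimately show ?case
      by (simp add: X_def A_def B_def mult_ac)
  qed
qed

end
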